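(* Let $n\ge1$ and let $\Phi:\Delta\to\Delta$ be the $n$-dimensional Minkowski function defined in the context. Then $\Phi$ is an orientation-preserving homeomorphism.
   Context: Fix an integer $n\ge1$ and identify $\mathbb{R}^n$ with the hyperplane $\{x_{n+1}=1\}$ of $\mathbb{R}^{n+1}$. A vector $(\alpha_1,\ldots,\alpha_{n+1})\in\mathbb{R}^{n+1}$ with $\alpha_{n+1}>0$ gives, in projective coordinates, the point $(\alpha_1/\alpha_{n+1},\ldots,\alpha_n/\alpha_{n+1})$ of $\mathbb{R}^n$. Let $V$ be the $(n+1)\times(n+1)$ matrix all of whose entries are $0$, except $V_{ij}=1$ whenever $i=n+1$, or $j\ge2$ and $i+j\le n+2$. Let $\Delta$ be the $n$-simplex whose vertices $v_1,\ldots,v_{n+1}$ are given in projective coordinates by the columns of $V$ (so $\Delta=\{1\ge x_1\ge x_2\ge\cdots\ge x_n\ge0\}$). Let $A_0$ be the $(n+1)\times(n+1)$ matrix whose entries are $0$ except for entries $1$ in positions $(1,1)$, $(1,n+1)$, $(2,n+1)$ and $(j+1,j)$ for $2\le j\le n$; let $A_1$ be the same matrix except that the $1$ in position $(1,1)$ is moved to position $(2,1)$. For $a=0,1$ let $\Delta_a$ be the simplex whose vertices are given in projective coordinates by the columns of $VA_a$; one has $\Delta=\Delta_0\cup\Delta_1$. For $a=0,1$ the matrix $M_a=VA_a^{-1}V^{-1}\in\mathrm{GL}_{n+1}(\mathbb{Z})$ induces a fractional-linear homeomorphism, also denoted $M_a$, from $\Delta_a$ to $\Delta$: the projective coordinates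 of $M_a(x)$ are $M_a(x_1\cdots x_n\,1)^{tr}$. The maps $M_0,M_1$ agree on $\Delta_0\cap\Delta_1$, and the Mönkemeyer map $M:\Delta\to\Delta$ is the continuous map with $M(x)=M_a(x)$ for $x\in\Delta_a$. In affine coordinates, $M(x_1,\ldots,x_n)=\bigl(\frac{x_1}{1-x_n},\frac{x_1-x_n}{1-x_n},\ldots,\frac{x_{n-1}-x_n}{1-x_n}\bigr)$ if $x_1+x_n\le1$ (i.e. on $\Delta_0$), and $M(x_1,\ldots,x_n)=\bigl(\frac{1-x_n}{x_1},\frac{x_1-x_n}{x_1},\ldots,\frac{x_{n-1}-x_n}{x_1}\bigr)$ if $x_1+x_n\ge1$ (i.e. on $\Delta_1$). For $a=0,1$ let $B_a$ be the matrix identical to $A_a$ except that the two $1$'s in the last column are replaced by $1/2$. The matrix $T_a=VB_a^{-1}V^{-1}$ has last row $(0\cdots0\,1)$ and induces an affine homeomorphism, also denoted $T_a$, from $\Delta_a$ to $\Delta$, by $T_a(x_1\cdots x_n\,1)^{tr}=(y_1\cdots y_n\,1)^{tr}$. The maps $T_0,T_1$ agree on $\Delta_0\cap\Delta_1$, and the tent map $T:\Delta\to\Delta$ is the continuous map with $T(x)=T_a(x)$ for $x\in\Delta_a$. In affine coordinates, $T(x_1,\ldots,x_n)=(x_1+x_n,x_1-x_n,\ldots,x_{n-1}-x_n)$ if $x_1+x_n\le1$, and $T(x_1,\ldots,x_n)=(2-x_1-x_n,x_1-x_n,\ldots,x_{n-1}-x_n)$ if $x_1+x_n\ge1$. (For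 $n=1$ only the first coordinate is present in these formulas.) For $a_0,\ldots,a_{t-1}\in\{0,1\}$ let $\Delta_{a_0\ldots a_{t-1}}=\{x\in\Delta:M^i(x)\in\Delta_{a_i}\text{ for }0\le i\le t-1\}$ and $\Gamma_{a_0\ldots a_{t-1}}=\{x\in\Delta:T^i(x)\in\Delta_{a_i}\text{ for }0\le i\le t-1\}$ (both equal to $\Delta$ for $t=0$). For an infinite sequence $\bar a=a_0a_1a_2\ldots\in\{0,1\}^{\mathbb{N}}$, let $\varphi(\bar a)$ be the unique point of $\bigcap_{t\ge0}\Delta_{a_0\ldots a_{t-1}}$ and $\upsilon(\bar a)$ the unique point of $\bigcap_{t\ge0}\Gamma_{a_0\ldots a_{t-1}}$. The map $\Phi:\Delta\to\Delta$ is defined by $\Phi(p)=\upsilon(\bar a)$ for any $\bar a$ with $\varphi(\bar a)=p$; this is a well-defined homeomorphism, and it is the unique homeomorphism of $\Delta$ such that $T=\Phi\circ M\circ\Phi^{-1}$. Orientation-preserving has its standard meaning: for a point $p$ of the topological interior $\Delta^\circ$, the isomorphism $H_n(\Delta,\Delta\setminus\{p\};\mathbb{Z})\to H_n(\Delta,\Delta\setminus\{\Phi(p)\};\mathbb{Z})$ induced by $\Phi$ is the identity, where the two infinite cyclic groups are canonically identified via $H_n(\Delta,\Delta\setminus B;\mathbb{Z})$ for any ball $B\subset\Delta^\circ$ containing $p$ and $\Phi(p)$. *)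

theory Defs
  imports
    "HOL-Homology.Homology"
    "Jordan_Normal_Form.Gauss_Jordan_Elimination"
begin

(* Points of R^n are the points of Euclidean_space n: the coordinate written x_i on paper
   (1 <= i <= n) is x (i - 1), and x i = 0 for i >= n.  The digits 0 and 1 are False and True. *)

section \<open>Projective coordinates\<close>

definition homog :: "nat \<Rightarrow> (nat \<Rightarrow> real) \<Rightarrow> real vec" where
  "homog n x = vec (n + 1) (\<lambda>i. if i < n then x i else 1)"

definition proj_point :: "nat \<Rightarrow> real vec \<Rightarrow> nat \<Rightarrow> real" where
  "proj_point n v = (\<lambda>i. if i < n then vec_index v i / vec_index v n else 0)"

definition column_simplex :: "nat \<Rightarrow> real mat \<Rightarrow> (nat \<Rightarrow> real) set" where
  "column_simplex n P = oriented_simplex n (\<lambda>j. proj_point n (col P j)) ` standard_simplex n"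

section \<open>The matrices\<close>

(* The entry function f receives the usual 1-based row and column indices. *)
definition square_mat :: "nat \<Rightarrow> (nat \<Rightarrow> nat \<Rightarrow> real) \<Rightarrow> real mat" where
  "square_mat n f = mat (n + 1) (n + 1) (\<lambda>(i, j). f (i + 1) (j + 1))"

definition mat_V :: "nat \<Rightarrow> real mat" where
  "mat_V n = square_mat n (\<lambda>i j. if i = n + 1 \<or> (j \<ge> 2 \<and> i + j \<le> n + 2) then 1 else 0)"

(* Common shape of A_a and B_a; c is the value of the two nonzero entries of the last column. *)
definition mat_AB :: "nat \<Rightarrow> real \<Rightarrow> bool \<Rightarrow> real mat" where
  "mat_AB n c a = square_mat n (\<lambda>i j.
     if (i, j) = (if a then (2, 1) else (1, 1)) then 1
     else if (i, j) = (1, n + 1) \<or> (i, j) = (2, n + 1) then c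
     else if 2 \<le> j \<and> j \<le> n \<and> i = j + 1 then 1
     else 0)"

definition mat_A :: "nat \<Rightarrow> bool \<Rightarrow> real mat" where
  "mat_A n a = mat_AB n 1 a"

definition mat_B :: "nat \<Rightarrow> bool \<Rightarrow> real mat" where
  "mat_B n a = mat_AB n (1 / 2) a"

definition inv_mat :: "real mat \<Rightarrow> real mat" where
  "inv_mat P = the (mat_inverse P)"

definition mat_M :: "nat \<Rightarrow> bool \<Rightarrow> real mat" where
  "mat_M n a = mat_V n * inv_mat (mat_A n a) * inv_mat (mat_V n)"

definition mat_T :: "nat \<Rightarrow> bool \<Rightarrow> real mat" where
  "mat_T n a = mat_V n * inv_mat (mat_B n a) * inv_mat (mat_V n)"

section \<open>The simplex, the Moenkemeyer map and the tent map\<close>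

definition Delta :: "nat \<Rightarrow> (nat \<Rightarrow> real) set" where
  "Delta n = column_simplex n (mat_V n)"

definition Delta_sub :: "nat \<Rightarrow> bool \<Rightarrow> (nat \<Rightarrow> real) set" where
  "Delta_sub n a = column_simplex n (mat_V n * mat_A n a)"

(* The two branches agree on the overlap of the two subsimplices, so the preference given to
   the branch 0 there is immaterial; likewise for the tent map. *)
definition moenkemeyer :: "nat \<Rightarrow> (nat \<Rightarrow> real) \<Rightarrow> nat \<Rightarrow> real" where
  "moenkemeyer n x = proj_point n (mat_M n (x \<notin> Delta_sub n False) *\<^sub>v homog n x)"

(* The last row of mat_T n a is (0 ... 0 1), so no division is needed here. *)
definition tent :: "nat \<Rightarrow> (nat \<Rightarrow> real) \<Rightarrow> nat \<Rightarrow> real" where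
  "tent n x = (\<lambda>i. if i < n
     then vec_index (mat_T n (x \<notin> Delta_sub n False) *\<^sub>v homog n x) i else 0)"

section \<open>Symbolic coding and the Minkowski function\<close>

definition cylinder ::
  "nat \<Rightarrow> ((nat \<Rightarrow> real) \<Rightarrow> nat \<Rightarrow> real) \<Rightarrow> (nat \<Rightarrow> bool) \<Rightarrow> nat \<Rightarrow> (nat \<Rightarrow> real) set" where
  "cylinder n F a t = {x \<in> Delta n. \<forall>i<t. (F ^^ i) x \<in> Delta_sub n (a i)}"

definition coded_point ::
  "nat \<Rightarrow> ((nat \<Rightarrow> real) \<Rightarrow> nat \<Rightarrow> real) \<Rightarrow> (nat \<Rightarrow> bool) \<Rightarrow> nat \<Rightarrow> real" where
  "coded_point n F a = (THE x. x \<in> (\<Inter>t. cylinder n F a t))"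

definition phi :: "nat \<Rightarrow> (nat \<Rightarrow> bool) \<Rightarrow> nat \<Rightarrow> real" where
  "phi n = coded_point n (moenkemeyer n)"

definition upsilon :: "nat \<Rightarrow> (nat \<Rightarrow> bool) \<Rightarrow> nat \<Rightarrow> real" where
  "upsilon n = coded_point n (tent n)"

definition Minkowski :: "nat \<Rightarrow> (nat \<Rightarrow> real) \<Rightarrow> nat \<Rightarrow> real" where
  "Minkowski n p = (THE q. \<exists>a. phi n a = p \<and> upsilon n a = q)"

section \<open>Preservation of orientation\<close>

definition Euclidean_sub :: "nat \<Rightarrow> (nat \<Rightarrow> real) set \<Rightarrow> (nat \<Rightarrow> real) topology" where
  "Euclidean_sub n S = subtopology (Euclidean_space n) S"

(* Balls are open or closed convex bodies (they are used below only inside a bounded set).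
   Round balls alone would not do: for two given interior points of a simplex there may be no
   round ball inside the interior containing both, whereas such a convex body always exists. *)
definition convex_ball :: "nat \<Rightarrow> (nat \<Rightarrow> real) set \<Rightarrow> bool" where
  "convex_ball n B \<longleftrightarrow>
     (openin (Euclidean_space n) B \<or> closedin (Euclidean_space n) B) \<and>
     Euclidean_space n interior_of B \<noteq> {} \<and>
     (\<forall>x\<in>B. \<forall>y\<in>B. \<forall>u\<in>{0..1}. (\<lambda>i. (1 - u) * x i + u * y i) \<in> B)"

(* The map H_n(S, S - B) -> H_n(S, S - {q}) induced by the identity. *)
definition localize ::
  "nat \<Rightarrow> (nat \<Rightarrow> real) set \<Rightarrow> (nat \<Rightarrow> real) set \<Rightarrow> (nat \<Rightarrow> real)
     \<Rightarrow> (nat \<Rightarrow> real) chain set \<Rightarrow> (nat \<Rightarrow> real) chain set" where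
  "localize n S B q =
     hom_induced (int n) (Euclidean_sub n S) (S - B) (Euclidean_sub n S) (S - {q}) id"

(* For a homeomorphism f of S and an interior point p, the isomorphism
   f_* : H_n(S, S - {p}) -> H_n(S, S - {f p}) has to be the identity once both groups are
   identified with H_n(S, S - B) by the maps localize n S B p and localize n S B (f p). *)
definition orientation_preserving ::
  "nat \<Rightarrow> (nat \<Rightarrow> real) set \<Rightarrow> ((nat \<Rightarrow> real) \<Rightarrow> nat \<Rightarrow> real) \<Rightarrow> bool" where
  "orientation_preserving n S f \<longleftrightarrow>
     (\<forall>p \<in> Euclidean_space n interior_of S.
        f p \<in> Euclidean_space n interior_of S \<and>
        (\<forall>B. convex_ball n B \<and> B \<subseteq> Euclidean_space n interior_of S \<and> p \<in> B \<and> f p \<in> B \<longrightarrow>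
           (\<forall>c \<in> carrier (relative_homology_group (int n) (Euclidean_sub n S) (S - B)).
              hom_induced (int n) (Euclidean_sub n S) (S - {p}) (Euclidean_sub n S) (S - {f p}) f
                (localize n S B p c)
              = localize n S B (f p) c)))"

end

(* In barycentric coordinates b_0, ..., b_n (ordered as the columns of V) both maps fold the simplex:
   they send b to (|b_0 - b_1|, b_2, ..., b_n, min(b_0, b_1) / c), normalised, with c = 1 for the
   Moenkemeyer map and c = 1/2 for the tent map. A cylinder is a simplex whose vertices evolve like a
   reserve vertex together with a queue of n others: the reserve u is mixed with the head q of the
   queue, the mixture joins the end of the queue, and either u or q becomes the reserve. The cylinders
   of a fixed code shrink to a point: if the reserve is eventually constant, all vertices converge to
   it harmonically; otherwise each replacement of the reserve starts a phase in which all weights are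
   comparable, and within n(n+2) further steps the oscillation of every linear functional drops by a
   fixed factor.

   Since the combinatorics of the cylinders does not depend on c, two codes have the same point for
   one map iff they do for the other, and a barycentric coordinate vanishes at the point of a code for
   one map iff it does for the other. So Phi is a homeomorphism, by compactness of the code space, and
   it maps each face to itself. The straight-line homotopy from Phi to the identity therefore preserves
   the boundary, and every class of H_n(Delta, Delta - B) comes from H_n(Delta, boundary) by radial
   projection. *)

theory Submission
  imports Defs "Jordan_Normal_Form.Determinant"
begin

subsection \<open>Mixing queues\<close>

text \<open>Position 0 is the reserve and positions 1 to \<open>n\<close> are the queue. \<open>L\<close> and \<open>H\<close> mark the entries
  that are still close to the minimum and to the maximum of the initial values: a mixture can only be
  marked if both of its parents carry the same mark.\<close>
locale low_high_queue =
  fixes n :: nat and a :: "nat \<Rightarrow> bool" and L H :: "nat \<Rightarrow> nat \<Rightarrow> bool"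
  assumes n_pos: "1 \<le> n"
    and disj: "L t j \<Longrightarrow> \<not> H t j"
    and L_shift: "L (Suc t) j \<Longrightarrow> 1 \<le> j \<Longrightarrow> j < n \<Longrightarrow> L t (Suc j)"
    and L_new: "L (Suc t) n \<Longrightarrow> L t 0 \<and> L t 1"
    and L_reserve: "L (Suc t) 0 \<Longrightarrow> L t (if a t then 1 else 0)"
    and H_shift: "H (Suc t) j \<Longrightarrow> 1 \<le> j \<Longrightarrow> j < n \<Longrightarrow> H t (Suc j)"
    and H_new: "H (Suc t) n \<Longrightarrow> H t 0 \<and> H t 1"
    and H_reserve: "H (Suc t) 0 \<Longrightarrow> H t (if a t then 1 else 0)"
begin

lemma swapped: "low_high_queue n a H L"
  by unfold_locales (use n_pos disj L_shift L_new L_reserve H_shift H_new H_reserve in blast)+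

definition marked :: "nat \<Rightarrow> nat set" where
  "marked t = {j \<in> {1..n}. L t j \<or> H t j}"

text \<open>A cyclic shift of the queue: a shifted entry comes from one place further back, and the
  new last entry is charged to the head that it consumes.\<close>

definition prev :: "nat \<Rightarrow> nat" where
  "prev j = (if j < n then Suc j else 1)"

lemma prev_marked: "prev ` marked (Suc t) \<subseteq> marked t"
  using L_shift H_shift L_new H_new n_pos by (fastforce simp: marked_def prev_def)

lemma inj_prev: "inj_on prev (marked t)"
  by (auto simp: inj_on_def marked_def prev_def split: if_splits)

lemma finite_marked [simp]: "finite (marked t)"
  by (simp add: marked_def)

text \<open>The injection \<open>prev\<close> charges every mark to an earlier one, so mixing never
  multiplies marks.\<close>

lemma card_marked_Suc: "card (marked (Suc t)) \<le> card (marked t)"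
  by (rule card_inj_on_le[OF inj_prev prev_marked finite_marked])

lemma card_marked_mono: "s \<le> t \<Longrightarrow> card (marked t) \<le> card (marked s)"
  using lift_Suc_antimono_le[of "\<lambda>t. card (marked t)"] card_marked_Suc by blast

text \<open>The mark of the head has no heir: \<open>prev\<close> misses position 1.\<close>

lemma card_marked_less:
  assumes "L t 1 \<or> H t 1" "\<not> L (Suc t) n" "\<not> H (Suc t) n"
  shows "card (marked (Suc t)) < card (marked t)"
proof -
  have "1 \<in> marked t" using assms(1) n_pos by (auto simp: marked_def)
  moreover have "1 \<notin> prev ` marked (Suc t)"
    using assms(2,3) by (auto simp: marked_def prev_def)
  ultimately have "prev ` marked (Suc t) \<subset> marked t"
    using prev_marked by blast
  then have "card (prev ` marked (Suc t)) < card (marked t)"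
    by (simp add: psubset_card_mono)
  then show ?thesis by (simp add: card_image inj_prev)
qed

text \<open>At some step a reserve that is not high is replaced by a high head. The mixture of these
  two carries neither mark, so the mark of the head is lost.\<close>

lemma card_marked_less_flip:
  assumes "i < j" "L i 0" "H j 0"
  shows "card (marked j) < card (marked i)"
proof -
  have "\<exists>k. i \<le> k \<and> k < j \<and> \<not> H k 0 \<and> H (Suc k) 0"
  proof (rule ccontr)
    assume *: "\<not> ?thesis"
    have "\<not> H k 0" if "i \<le> k" "k \<le> j" for k
      using that
    proof (induction k rule: dec_induct)
      case base show ?case using disj assms(2) by blast
    next
      case (step m) then show ?case using * by (meson Suc_leD Suc_le_lessD)
    qed
    then show False using assms(1,3) by auto
  qed
  then obtain k where k: "i \<le> k" "k < j" "\<not> H k 0" "H (Suc k) 0" by blast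
  then have "H k 1" using H_reserve[OF k(4)] by (auto split: if_splits)
  then have "card (marked (Suc k)) < card (marked k)"
    using card_marked_less[of k] k L_new H_new disj by blast
  then show ?thesis using card_marked_mono[of i k] card_marked_mono[of "Suc k" j] k by linarith
qed

text \<open>The queue is completely renewed within \<open>n\<close> steps, so the entry was mixed in
  that window, and a low mixture needs a low reserve at that moment.\<close>

lemma L_origin:
  assumes "L (t + n) j" "1 \<le> j" "j \<le> n"
  shows "\<exists>i\<ge>t. i < t + n \<and> L i 0"
proof -
  have backwards: "L (s + i) j \<Longrightarrow> j + i \<le> n \<Longrightarrow> L s (j + i)" for s i
  proof (induction i arbitrary: s)
    case (Suc i)
    then have "L (Suc s) (j + i)" by (metis Suc_leD add_Suc add_Suc_right)
    then show ?case using L_shift[of s "j + i"] Suc.prems assms(2) by simp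
  qed simp
  \<comment> \<open>Going back \<open>n - j\<close> steps puts the entry at the end of the queue,
    one step after its mixing.\<close>
  have "L (t + j) n" using backwards[of "t + j" "n - j"] assms by (simp add: add.commute)
  then show ?thesis using L_new[of "t + j - 1"] assms(2,3)
    by (intro exI[of _ "t + j - 1"]) auto
qed

lemma L_persist: "\<exists>j\<in>{1..n}. L (t + k) j \<Longrightarrow> \<exists>j\<in>{1..n}. L t j"
proof (induction k)
  case (Suc k)
  then obtain j where j: "j \<in> {1..n}" "L (Suc (t + k)) j" by auto
  then have "\<exists>j\<in>{1..n}. L (t + k) j"
    using L_shift[of "t + k" j] L_new[of "t + k"] n_pos by (cases "j = n") force+
  then show ?case by (rule Suc.IH)
qed auto

text \<open>If both marks survive a round in the queue, the reserve has been low at one moment and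
  high at another, and such a change costs a mark.\<close>

lemma card_marked_round:
  assumes "\<exists>j\<in>{1..n}. L (t + n) j" "\<exists>j\<in>{1..n}. H (t + n) j"
  shows "card (marked (t + n)) < card (marked t)"
proof -
  interpret sw: low_high_queue n a H L by (rule swapped)
  obtain i where i: "i \<ge> t" "i < t + n" "L i 0" using assms(1) L_origin by (meson atLeastAtMost_iff)
  obtain j where j: "j \<ge> t" "j < t + n" "H j 0" using assms(2) sw.L_origin by (meson atLeastAtMost_iff)
  have "i \<noteq> j" using i j disj by auto
  then consider "i < j" | "j < i" by linarith
  then have "\<exists>k l. t \<le> k \<and> l \<le> t + n \<and> card (marked l) < card (marked k)"
  proof cases
    case 1 then show ?thesis using card_marked_less_flip[of i j] i j by (metis less_imp_le)
  next
    case 2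
    have "sw.marked = marked" unfolding sw.marked_def marked_def by auto
    then show ?thesis using 2 sw.card_marked_less_flip[of j i] i j by (metis less_imp_le)
  qed
  then show ?thesis using card_marked_mono by (meson dual_order.strict_trans1 dual_order.strict_trans2)
qed

text \<open>With no low entry in the queue only the reserve can be low, and it must have been low
  during the whole round. Then no high mixture was formed, although the queue was completely
  renewed.\<close>

lemma no_L_later:
  assumes "\<not> (\<exists>j\<in>{1..n}. L T j)" "\<exists>j\<le>n. L (T + n) j"
  shows "\<not> (\<exists>j\<le>n. H (T + n) j)"
proof
  assume "\<exists>j\<le>n. H (T + n) j"
  then obtain j where j: "j \<le> n" "H (T + n) j" by blast
  have noL: "\<not> L (T + k) j" if "1 \<le> j" "j \<le> n" for k j
    using L_persist assms(1) that by (meson atLeastAtMost_iff)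
  then have "L (T + n) 0"
    using assms(2) by (metis One_nat_def not_less_eq_eq le_zero_eq)
  have L0: "L (T + k) 0" if "k \<le> n" for k
    using that
  proof (induction k rule: inc_induct)
    case (step k)
    show ?case using L_reserve[of "T + k"] noL[of 1 k] step n_pos by (auto split: if_splits)
  qed (fact \<open>L (T + n) 0\<close>)
  interpret sw: low_high_queue n a H L by (rule swapped)
  show False
  proof (cases "j = 0")
    case True then show False using j disj L0[of n] by auto
  next
    case False
    then obtain i where "i \<ge> T" "i < T + n" "H i 0" using sw.L_origin[of T j] j by auto
    then show False using L0[of "i - T"] disj by auto
  qed
qed

text \<open>Each of the first \<open>n + 1\<close> rounds would lose at least one of at most
  \<open>n\<close> marks. The last round takes care of a mark that survives in the reserve
  only.\<close>

lemma not_both_eventually: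
  "\<not> ((\<exists>j\<le>n. L (n * (n + 2)) j) \<and> (\<exists>j\<le>n. H (n * (n + 2)) j))"
proof
  assume both: "(\<exists>j\<le>n. L (n * (n + 2)) j) \<and> (\<exists>j\<le>n. H (n * (n + 2)) j)"
  interpret sw: low_high_queue n a H L by (rule swapped)
  define T where "T = n * (n + 1)"
  have TN: "n * (n + 2) = T + n" by (simp add: T_def)
  have "(\<exists>j\<in>{1..n}. L T j) \<and> (\<exists>j\<in>{1..n}. H T j)"
    using no_L_later[of T] sw.no_L_later[of T] both unfolding TN by blast
  then have "(\<exists>j\<in>{1..n}. L (n * r) j) \<and> (\<exists>j\<in>{1..n}. H (n * r) j)" if "r \<le> n + 1" for r
    using L_persist[of "n * r" "n * (n + 1 - r)"] sw.L_persist[of "n * r" "n * (n + 1 - r)"] that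
    unfolding T_def by (metis add_mult_distrib2 le_add_diff_inverse)
  then have step: "card (marked (n * Suc r)) < card (marked (n * r))" if "r \<le> n" for r
    using card_marked_round[of "n * r"] that
    by (metis Suc_eq_plus1 Suc_le_mono add.commute mult_Suc_right)
  have "card (marked (n * r)) + r \<le> card (marked 0)" if "r \<le> n + 1" for r
    using that
  proof (induction r)
    case (Suc r) then show ?case using step[of r] by simp
  qed simp
  from this[of "n + 1"] have "n + 1 \<le> card (marked 0)" by simp
  moreover have "card (marked 0) \<le> card {1..n}"
    unfolding marked_def by (intro card_mono) auto
  ultimately show False by simp
qed

end

text \<open>The margins that define the two marks shrink by the factor \<open>e t\<close> at every
  step, so a mixture can pass the new threshold only if both of its parts pass the old one. Once one
  mark has died out, all entries keep a fixed distance from one end of the interval.\<close>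

lemma mixing_queue_contraction:
  fixes x :: "nat \<Rightarrow> nat \<Rightarrow> real"
  assumes n: "1 \<le> n"
    and reserve: "\<And>t. x (Suc t) 0 = x t (if a t then 1 else 0)"
    and shift: "\<And>t j. 1 \<le> j \<Longrightarrow> j < n \<Longrightarrow> x (Suc t) j = x t (Suc j)"
    and new: "\<And>t. x (Suc t) n = (1 - w t) * x t 0 + w t * x t 1"
    and w: "\<And>t. 0 < e t" "\<And>t. e t \<le> w t" "\<And>t. w t \<le> 1 - e t"
    and bounds: "\<And>j. j \<le> n \<Longrightarrow> A \<le> x 0 j \<and> x 0 j \<le> B"
  defines "N \<equiv> n * (n + 2)"
  defines "\<theta> \<equiv> (\<Prod>i<N. e i) / 2"
  shows "(\<forall>j\<le>n. A + \<theta> * (B - A) \<le> x N j) \<or> (\<forall>j\<le>n. x N j \<le> B - \<theta> * (B - A))"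
proof -
  \<comment> \<open>The factor 1/2 makes the low range and the high range disjoint.\<close>
  define h where "h t = (\<Prod>i<t. e i) / 2" for t
  have h_Suc: "h (Suc t) = e t * h t" for t by (simp add: h_def)
  have e1: "e t \<le> 1 / 2" for t using w(2,3)[of t] by linarith
  have h_pos: "0 < h t" for t using w(1) by (simp add: h_def prod_pos)
  have h_dec: "h (Suc t) \<le> h t" for t
    unfolding h_Suc using e1[of t] h_pos[of t] by (intro mult_left_le_one_le) (auto simp: w(1) less_imp_le)
  have h_half: "h t \<le> 1 / 2" for t
    using h_dec by (induction t) (auto simp: h_def intro: order_trans)
  have AB: "A \<le> B" using bounds[of 0] by linarith
  have cases_j: "j \<le> n \<Longrightarrow> j = 0 \<or> j = n \<or> (1 \<le> j \<and> j < n)" for j by linarith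
  have w01: "0 \<le> w t" "w t \<le> 1" for t using w[of t] by linarith+
  have bd: "A \<le> x t j \<and> x t j \<le> B" if "j \<le> n" for t j
    using that
  proof (induction t arbitrary: j)
    case (Suc t)
    note IH = Suc.IH
    from cases_j[OF Suc.prems] show ?case
    proof (elim disjE)
      assume "j = 0" then show ?thesis using IH n by (simp add: reserve)
    next
      assume "j = n"
      have c: "(1 - w t) * A + w t * A \<le> (1 - w t) * x t 0 + w t * x t 1"
        using w01[of t] IH[of 0] IH[of 1] n by (intro add_mono mult_left_mono) auto
      have d: "(1 - w t) * x t 0 + w t * x t 1 \<le> (1 - w t) * B + w t * B"
        using w01[of t] IH[of 0] IH[of 1] n by (intro add_mono mult_left_mono) auto
      show ?thesis using c d \<open>j = n\<close> by (simp add: new algebra_simps)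
    next
      assume "1 \<le> j \<and> j < n" then show ?thesis using IH by (simp add: shift)
    qed
  qed (use bounds in auto)
  define L where "L t j \<longleftrightarrow> j \<le> n \<and> x t j < A + h t * (B - A)" for t j
  define H where "H t j \<longleftrightarrow> j \<le> n \<and> B - h t * (B - A) < x t j" for t j
  have dec: "h (Suc t) * (B - A) \<le> h t * (B - A)" for t
    using h_dec AB by (intro mult_right_mono) auto
  interpret low_high_queue n a L H
  proof
    show "1 \<le> n" by fact
  next
    fix t j assume "L t j"
    moreover have "h t * (B - A) \<le> 1 / 2 * (B - A)"
      using h_half AB by (intro mult_right_mono) auto
    ultimately show "\<not> H t j" unfolding L_def H_def by (auto simp: field_simps)
  next
    fix t j assume "L (Suc t) j" "1 \<le> j" "j < n"
    then show "L t (Suc j)" using dec[of t] by (auto simp: L_def shift)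
  next
    fix t j assume "H (Suc t) j" "1 \<le> j" "j < n"
    then show "H t (Suc j)" using dec[of t] by (auto simp: H_def shift)
  next
    fix t assume "L (Suc t) 0"
    then show "L t (if a t then 1 else 0)" using dec[of t] n by (auto simp: L_def reserve)
  next
    fix t assume "H (Suc t) 0"
    then show "H t (if a t then 1 else 0)" using dec[of t] n by (auto simp: H_def reserve)
  next
    fix t assume "L (Suc t) n"
    then have lt: "(1 - w t) * (x t 0 - A) + w t * (x t 1 - A) < e t * (h t * (B - A))"
      by (simp add: L_def new h_Suc algebra_simps)
    have nn: "0 \<le> x t 0 - A" "0 \<le> x t 1 - A" "0 \<le> h t * (B - A)"
      using bd[of 0 t] bd[of 1 t] n h_pos[of t] AB by auto
    \<comment> \<open>Both summands of the mixture are nonnegative, so each alone obeys the bound;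
      cancelling \<open>e t\<close> leaves the old threshold for either parent.\<close>
    have "e t * (x t 0 - A) \<le> (1 - w t) * (x t 0 - A)" "0 \<le> w t * (x t 1 - A)"
      "e t * (x t 1 - A) \<le> w t * (x t 1 - A)" "0 \<le> (1 - w t) * (x t 0 - A)"
      using nn w[of t] w01[of t] by (auto intro!: mult_right_mono mult_nonneg_nonneg)
    then have "e t * (x t 0 - A) < e t * (h t * (B - A))" "e t * (x t 1 - A) < e t * (h t * (B - A))"
      using lt by linarith+
    then show "L t 0 \<and> L t 1" using w(1)[of t] n by (simp add: L_def)
  next
    fix t assume "H (Suc t) n"
    then have lt: "(1 - w t) * (B - x t 0) + w t * (B - x t 1) < e t * (h t * (B - A))"
      by (simp add: H_def new h_Suc algebra_simps)
    have nn: "0 \<le> B - x t 0" "0 \<le> B - x t 1" "0 \<le> h t * (B - A)"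
      using bd[of 0 t] bd[of 1 t] n h_pos[of t] AB by auto
    have "e t * (B - x t 0) \<le> (1 - w t) * (B - x t 0)" "0 \<le> w t * (B - x t 1)"
      "e t * (B - x t 1) \<le> w t * (B - x t 1)" "0 \<le> (1 - w t) * (B - x t 0)"
      using nn w[of t] w01[of t] by (auto intro!: mult_right_mono mult_nonneg_nonneg)
    then have "e t * (B - x t 0) < e t * (h t * (B - A))" "e t * (B - x t 1) < e t * (h t * (B - A))"
      using lt by linarith+
    then show "H t 0 \<and> H t 1" using w(1)[of t] n by (auto simp: H_def)
  qed
  have "\<theta> = h N" by (simp add: \<theta>_def h_def)
  then show ?thesis using not_both_eventually unfolding N_def[symmetric] L_def H_def
    by (meson not_le)
qed

text \<open>The values of the functional \<open>p\<close> on the columns of the product of the first \<open>t\<close> matrices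
  \<open>A\<close> (for \<open>c = 1\<close>) or \<open>B\<close> (for \<open>c = 1 / 2\<close>) selected by the code \<open>a\<close>.\<close>
primrec queue :: "nat \<Rightarrow> real \<Rightarrow> (nat \<Rightarrow> bool) \<Rightarrow> (nat \<Rightarrow> real) \<Rightarrow> nat \<Rightarrow> nat \<Rightarrow> real" where
  "queue n c a p 0 = p"
| "queue n c a p (Suc t) = (\<lambda>j.
     if j = 0 then queue n c a p t (if a t then 1 else 0)
     else if j < n then queue n c a p t (Suc j)
     else c * (queue n c a p t 0 + queue n c a p t 1))"

lemma queue_shift: "1 \<le> j \<Longrightarrow> j + i \<le> n \<Longrightarrow> queue n c a p (t + i) j = queue n c a p t (j + i)"
proof (induction i arbitrary: j)
  case (Suc i)
  then show ?case using Suc.IH[of "Suc j"] by simp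
qed simp

lemma queue_no_switch_0: "s \<le> t \<Longrightarrow> \<forall>t\<ge>s. \<not> a t \<Longrightarrow> queue n c a p t 0 = queue n c a p s 0"
  by (induction t rule: dec_induct) auto

text \<open>While the reserve is fixed, \<open>n\<close> steps mix every entry of the queue with it
  exactly once.\<close>

lemma queue_no_switch_round:
  assumes "\<forall>t\<ge>s. \<not> a t" "1 \<le> j" "j \<le> n"
  shows "queue n c a p (s + n) j = c * (queue n c a p s 0 + queue n c a p s j)"
proof -
  have n0: "n \<noteq> 0" using assms by linarith
  \<comment> \<open>The entry becomes the head after \<open>j - 1\<close> steps, and the next step
    mixes it.\<close>
  have "queue n c a p (s + n) j = queue n c a p (Suc (s + (j - 1))) n"
    using queue_shift[of j "n - j" n c a p "s + j"] assms by (simp add: add.commute)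
  also have "\<dots> = c * (queue n c a p (s + (j - 1)) 0 + queue n c a p (s + (j - 1)) 1)"
    using n0 by (simp only: queue.simps if_False less_irrefl)
  also have "queue n c a p (s + (j - 1)) 0 = queue n c a p s 0"
    by (rule queue_no_switch_0) (use assms in auto)
  also have "queue n c a p (s + (j - 1)) 1 = queue n c a p s j"
    using queue_shift[of 1 "j - 1" n c a p s] assms by simp
  finally show ?thesis .
qed

section \<open>Weights and values at the vertices of a cylinder\<close>

locale vertex_queue =
  fixes n :: nat and c :: real and a :: "nat \<Rightarrow> bool" and p :: "nat \<Rightarrow> real"
  assumes n_pos: "1 \<le> n" and c: "c = 1 \<or> c = 1 / 2"
begin

definition P :: "nat \<Rightarrow> nat \<Rightarrow> real" where "P = queue n c a p"
text \<open>The weights are the column sums of the matrix product, so \<open>P t j / d t j\<close>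
  is the value of the functional at vertex \<open>j\<close> of the cylinder.\<close>

definition d :: "nat \<Rightarrow> nat \<Rightarrow> real" where "d = queue n c a (\<lambda>_. 1)"

text \<open>Multiplied by the weights, so that bounds on the vertex values pass through the linear
  recursion.\<close>

definition ratios_in :: "nat \<Rightarrow> real \<Rightarrow> real \<Rightarrow> bool" where
  "ratios_in t A B \<longleftrightarrow> (\<forall>j\<le>n. A * d t j \<le> P t j \<and> P t j \<le> B * d t j)"

lemma queue_Suc_0: "P (Suc t) 0 = P t (if a t then 1 else 0)" "d (Suc t) 0 = d t (if a t then 1 else 0)"
  by (simp_all add: P_def d_def)

lemma queue_Suc_shift: "1 \<le> j \<Longrightarrow> j < n \<Longrightarrow> P (Suc t) j = P t (Suc j)"
  "1 \<le> j \<Longrightarrow> j < n \<Longrightarrow> d (Suc t) j = d t (Suc j)"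
  by (simp_all add: P_def d_def)

lemma queue_Suc_last: "P (Suc t) n = c * (P t 0 + P t 1)" "d (Suc t) n = c * (d t 0 + d t 1)"
  using n_pos by (simp_all add: P_def d_def)

lemma c01: "0 < c" "c \<le> 1"
  using c by auto

lemma index_cases: "j \<le> n \<Longrightarrow> j = 0 \<or> j = n \<or> (1 \<le> j \<and> j < n)"
  by linarith

text \<open>The last inequality is what keeps the weights sorted.\<close>
lemma d_sorted: "0 < d t 0 \<and> (\<forall>j<n. d t j \<le> d t (Suc j)) \<and> d t n \<le> d t 0 + d t 1"
proof (cases "c = 1")
  case True
  show ?thesis
  proof (induction t)
    case 0 show ?case by (simp add: d_def)
  next
    case (Suc t)
    have d01: "d t 0 \<le> d t 1" "0 < d t 1" using Suc n_pos by force+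
    have "d (Suc t) j \<le> d (Suc t) (Suc j)" if "j < n" for j
    proof (cases "Suc j = n")
      case True
      then show ?thesis using Suc d01 n_pos \<open>c = 1\<close> queue_Suc_last queue_Suc_0 queue_Suc_shift
        by (cases "j = 0") auto
    next
      case False
      then have "Suc j < n" using \<open>j < n\<close> by linarith
      have "d t 1 \<le> d t (Suc 1)" if "j = 0"
        using conjunct1[OF conjunct2[OF Suc], rule_format, of 1] False \<open>j < n\<close> that by simp
      moreover have "d t (Suc j) \<le> d t (Suc (Suc j))" using Suc \<open>Suc j < n\<close> by blast
      moreover have "d (Suc t) (Suc j) = d t (Suc (Suc j))" "1 \<le> j \<Longrightarrow> d (Suc t) j = d t (Suc j)"
        using \<open>Suc j < n\<close> by (simp_all add: queue_Suc_shift)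
      moreover have "d (Suc t) 0 \<le> d t 1" using d01 by (simp add: queue_Suc_0)
      ultimately show ?thesis by (cases "j = 0") auto
    qed
    moreover have "d (Suc t) n \<le> d (Suc t) 0 + d (Suc t) 1"
    proof (cases "n = 1")
      case True
      then show ?thesis using queue_Suc_last(2)[of t] queue_Suc_0(2)[of t] Suc d01 \<open>c = 1\<close> by auto
    next
      case False
      then have "d t 1 \<le> d t (Suc 1)" "d (Suc t) 1 = d t (Suc 1)" "d t 0 \<le> d (Suc t) 0"
        using conjunct1[OF conjunct2[OF Suc], rule_format, of 1] n_pos queue_Suc_shift(2)[of 1 t] d01
        by (auto simp: queue_Suc_0)
      then show ?thesis using queue_Suc_last(2)[of t] \<open>c = 1\<close> by simp
    qed
    ultimately show ?case using Suc d01 by (auto simp: queue_Suc_0)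
  qed
next
  case False
  then have "c = 1 / 2" using c by auto
  \<comment> \<open>Mixing with \<open>c = 1 / 2\<close> is averaging, so the weights stay equal to
    1.\<close>
  have "d t = (\<lambda>_. 1)"
  proof (induction t)
    case (Suc t)
    have "d (Suc t) = (\<lambda>j. if j = 0 then d t (if a t then 1 else 0)
        else if j < n then d t (Suc j) else c * (d t 0 + d t 1))"
      unfolding d_def queue.simps ..
    then show ?case unfolding Suc by (simp add: \<open>c = 1 / 2\<close> fun_eq_iff)
  qed (simp add: d_def)
  then show ?thesis by simp
qed

lemma d_mono: "i \<le> j \<Longrightarrow> j \<le> n \<Longrightarrow> d t i \<le> d t j"
proof (induction j rule: dec_induct)
  case (step m) then show ?case using d_sorted[of t] by (meson Suc_leD Suc_le_lessD order_trans)
qed simp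

lemma d_pos: "j \<le> n \<Longrightarrow> 0 < d t j"
  using d_sorted[of t] d_mono[of 0 j t] by linarith

text \<open>The new vertex value is a weighted mean of two old ones.\<close>

lemma ratios_in_Suc: "ratios_in t A B \<Longrightarrow> ratios_in (Suc t) A B"
  unfolding ratios_in_def
proof (intro allI impI)
  fix j assume w: "\<forall>j\<le>n. A * d t j \<le> P t j \<and> P t j \<le> B * d t j" and "j \<le> n"
  from index_cases[OF \<open>j \<le> n\<close>] show "A * d (Suc t) j \<le> P (Suc t) j \<and> P (Suc t) j \<le> B * d (Suc t) j"
  proof (elim disjE)
    assume "j = n"
    have "A * (d t 0 + d t 1) \<le> P t 0 + P t 1" "P t 0 + P t 1 \<le> B * (d t 0 + d t 1)"
      using w n_pos by (auto simp: distrib_left intro: add_mono)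
    then have "c * (A * (d t 0 + d t 1)) \<le> c * (P t 0 + P t 1)" "c * (P t 0 + P t 1) \<le> c * (B * (d t 0 + d t 1))"
      using c01 by (auto intro: mult_left_mono)
    then show ?thesis by (simp add: \<open>j = n\<close> queue_Suc_last mult.left_commute)
  qed (use w n_pos in \<open>auto simp: queue_Suc_0 queue_Suc_shift\<close>)
qed

lemma ratios_in_later:
  assumes "ratios_in s A B" "s \<le> t"
  shows "ratios_in t A B"
  using assms(2) by (induction t rule: dec_induct) (auto intro: ratios_in_Suc assms(1))

lemma ratios_in_initial: "ratios_in 0 (- (\<Sum>j\<le>n. \<bar>p j\<bar>)) (\<Sum>j\<le>n. \<bar>p j\<bar>)"
proof -
  have "\<bar>p j\<bar> \<le> (\<Sum>j\<le>n. \<bar>p j\<bar>)" if "j \<le> n" for j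
    by (rule member_le_sum[of j "{..n}" "\<lambda>j. \<bar>p j\<bar>"]) (use that in auto)
  then show ?thesis by (force simp: ratios_in_def P_def d_def)
qed

text \<open>Right after a switch the reserve is comparable to the whole queue, so the next mixing
  steps are uniformly nondegenerate.\<close>
lemma d_growth_after_switch:
  assumes "a s"
  shows "d (Suc s + i) n \<le> 2 ^ Suc i * d (Suc s) 0 \<and> d (Suc s) 0 \<le> d (Suc s + i) 0"
proof (induction i)
  case 0
  have "c * (d s 0 + d s 1) \<le> 1 * (2 * d s 1)"
    using c01 d_mono[of 0 1 s] d_pos[of 0 s] d_pos[of 1 s] n_pos by (intro mult_mono) auto
  then show ?case using assms queue_Suc_last(2)[of s] by (simp add: queue_Suc_0)
next
  case (Suc i)
  let ?t = "Suc s + i"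
  have "c * (d ?t 0 + d ?t 1) \<le> 1 * (2 * d ?t n)"
    using c01 d_mono[of 0 n ?t] d_mono[of 1 n ?t] d_pos[of 0 ?t] d_pos[of 1 ?t] n_pos by (intro mult_mono) auto
  then have "d (Suc ?t) n \<le> 2 ^ Suc (Suc i) * d (Suc s) 0" using Suc queue_Suc_last(2)[of ?t] by simp
  moreover have "d ?t 0 \<le> d (Suc ?t) 0" using d_mono[of 0 1 ?t] n_pos by (simp add: queue_Suc_0)
  ultimately show ?case using Suc by simp
qed

text \<open>The loss factor of \<open>mixing_queue_contraction\<close> for the weight bounds
  available after a switch.\<close>

definition \<theta> :: real where
  "\<theta> = (\<Prod>i<n * (n + 2). 1 / (1 + 2 ^ Suc i)) / 2"

lemma \<theta>_bounds: "0 < \<theta>" "\<theta> \<le> 1 / 2"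
proof -
  have "(\<Prod>i<n * (n + 2). 1 / (1 + 2 ^ Suc i)) \<le> (1::real)"
    by (rule prod_le_1) (auto simp: divide_le_eq_1 add_pos_pos)
  then show "\<theta> \<le> 1 / 2" by (simp add: \<theta>_def)
  have "0 < (\<Prod>i<n * (n + 2). 1 / (1 + 2 ^ Suc i) :: real)"
    by (rule prod_pos) (auto intro!: divide_pos_pos add_pos_pos)
  then show "0 < \<theta>" by (simp add: \<theta>_def)
qed

text \<open>The vertex values form a mixing queue in which the head has weight \<open>w\<close>.
  Sorted weights give \<open>w i \<ge> 1 / 2\<close>, and the growth bound after a switch keeps
  \<open>1 - w i\<close> away from 0 by an amount that depends only on \<open>i\<close>.\<close>

lemma switch_contraction:
  assumes "a s" "ratios_in (Suc s) A B"
  shows "\<exists>A' B'. B' - A' = (1 - \<theta>) * (B - A) \<and> ratios_in (Suc s + n * (n + 2)) A' B'"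
proof -
  define T where "T i = Suc s + i" for i
  define x where "x i j = P (T i) j / d (T i) j" for i j
  define w where "w i = d (T i) 1 / (d (T i) 0 + d (T i) 1)" for i
  have T_Suc: "T (Suc i) = Suc (T i)" for i by (simp add: T_def)
  have pos: "0 < d (T i) 0" "0 < d (T i) 1" for i using d_pos n_pos by auto
  have "(\<forall>j\<le>n. A + \<theta> * (B - A) \<le> x (n * (n + 2)) j) \<or> (\<forall>j\<le>n. x (n * (n + 2)) j \<le> B - \<theta> * (B - A))"
    unfolding \<theta>_def
  proof (rule mixing_queue_contraction[where w = w and a = "\<lambda>i. a (T i)"])
    show "1 \<le> n" by (rule n_pos)
    show "x (Suc i) 0 = x i (if a (T i) then 1 else 0)" for i
      by (simp add: x_def T_Suc queue_Suc_0)
    show "x (Suc i) j = x i (Suc j)" if "1 \<le> j" "j < n" for i j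
      using that by (simp add: x_def T_Suc queue_Suc_shift)
    show "x (Suc i) n = (1 - w i) * x i 0 + w i * x i 1" for i
    proof -
      have "1 - w i = d (T i) 0 / (d (T i) 0 + d (T i) 1)"
        using pos[of i] by (simp add: w_def field_simps)
      then show ?thesis using pos[of i] c01
        by (simp add: w_def x_def T_Suc queue_Suc_last add_divide_distrib)
    qed
    show "0 < (1 / (1 + 2 ^ Suc i) :: real)" for i
      by (auto intro!: divide_pos_pos add_pos_pos)
    have le: "1 \<le> (2::real) ^ Suc i" for i by (rule one_le_power) simp
    show "1 / (1 + 2 ^ Suc i) \<le> w i" for i
    proof -
      have "1 / (1 + 2 ^ Suc i) \<le> (1 / 2 :: real)" using le[of i] by (intro divide_left_mono) auto
      also have "\<dots> \<le> w i" using pos[of i] d_mono[of 0 1 "T i"] n_pos by (simp add: w_def field_simps)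
      finally show ?thesis .
    qed
    show "w i \<le> 1 - 1 / (1 + 2 ^ Suc i)" for i
    proof -
      have "d (T i) 1 \<le> d (T i) n" using d_mono n_pos by simp
      also have "\<dots> \<le> 2 ^ Suc i * d (Suc s) 0" using d_growth_after_switch[OF assms(1), of i] by (simp add: T_def)
      also have "\<dots> \<le> 2 ^ Suc i * d (T i) 0"
        using d_growth_after_switch[OF assms(1), of i] by (intro mult_left_mono) (auto simp: T_def)
      finally have "d (T i) 0 + d (T i) 1 \<le> (1 + 2 ^ Suc i) * d (T i) 0" by (simp add: algebra_simps)
      then have "1 / (1 + 2 ^ Suc i) \<le> d (T i) 0 / (d (T i) 0 + d (T i) 1)"
        using pos[of i] le[of i] by (simp add: divide_simps mult.commute)
      also have "\<dots> = 1 - w i" using pos[of i] by (simp add: w_def field_simps)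
      finally show ?thesis by linarith
    qed
    show "A \<le> x 0 j \<and> x 0 j \<le> B" if "j \<le> n" for j
      using assms(2) that d_pos[OF that, of "T 0"] by (auto simp: ratios_in_def x_def T_def divide_simps)
  qed
  moreover have "ratios_in (Suc s + n * (n + 2)) A B" using assms(2) ratios_in_later by simp
  ultimately have "ratios_in (Suc s + n * (n + 2)) (A + \<theta> * (B - A)) B \<or> ratios_in (Suc s + n * (n + 2)) A (B - \<theta> * (B - A))"
    unfolding ratios_in_def x_def T_def using d_pos by (auto simp: divide_simps)
  then show ?thesis
  proof
    assume w: "ratios_in (Suc s + n * (n + 2)) (A + \<theta> * (B - A)) B"
    show ?thesis by (intro exI[of _ B] exI[of _ "A + \<theta> * (B - A)"] conjI w) (simp add: algebra_simps)
  next
    assume w: "ratios_in (Suc s + n * (n + 2)) A (B - \<theta> * (B - A))"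
    show ?thesis by (intro exI[of _ "B - \<theta> * (B - A)"] exI[of _ A] conjI w) (simp add: algebra_simps)
  qed
qed

text \<open>Up to the common factor \<open>c\<close>, each round adds the weight of the reserve to
  every queue entry and leaves the weighted deviation from the value of the reserve unchanged. The
  weights grow at most linearly, so the relative deviation after \<open>k\<close> rounds is at most
  of order \<open>1 / k\<close>.\<close>

lemma no_switch_shrink:
  assumes ns: "\<forall>t\<ge>s. \<not> a t" and "0 < e"
  shows "\<exists>t A B. B - A \<le> e \<and> ratios_in t A B"
proof -
  define M where "M = (\<Sum>j\<le>n. \<bar>p j\<bar>)"
  have M: "ratios_in s (- M) M" using ratios_in_initial ratios_in_later by (auto simp: M_def)
  \<comment> \<open>\<open>u\<close> and \<open>v\<close> are the weight and the value of the fixed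
    reserve, \<open>C\<close> bounds the initial weights relative to \<open>u\<close>, and
    \<open>E\<close> bounds the initial relative deviation from \<open>v\<close>.\<close>
  define u v C E where "u = d s 0" and "v = P s 0 / u" and "C = d s n / u" and "E = 2 * M"
  have u: "0 < u" using d_pos by (simp add: u_def)
  have C: "1 \<le> C" using u d_mono[of 0 n s] by (simp add: C_def u_def)
  have M0: "0 \<le> M" by (simp add: M_def sum_nonneg)
  have vM: "\<bar>v\<bar> \<le> M" using M u by (auto simp: ratios_in_def v_def u_def abs_le_iff divide_simps)
  have main: "\<forall>j\<le>n. d (s + k * n) j \<le> (real k + C) * u \<and>
     \<bar>P (s + k * n) j - v * d (s + k * n) j\<bar> \<le> E * C / (real k + C) * d (s + k * n) j" for k
  proof (induction k)
    case 0
    have "\<bar>P s j - v * d s j\<bar> \<le> E * d s j" if "j \<le> n" for j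
    proof -
      have "\<bar>P s j\<bar> \<le> M * d s j" using M that by (auto simp: ratios_in_def abs_le_iff)
      moreover have "\<bar>v * d s j\<bar> \<le> M * d s j" using vM d_pos[OF that, of s] by (simp add: abs_mult mult_right_mono)
      ultimately show ?thesis by (simp add: E_def)
    qed
    then show ?case using C u d_mono[of _ n s] by (simp add: C_def)
  next
    case (Suc k)
    let ?t = "s + k * n"
    have eq: "s + Suc k * n = ?t + n" by simp
    have k0: "0 < real k + C" using C by simp
    have ns': "\<forall>t\<ge>?t. \<not> a t" using ns by simp
    have P0: "P ?t 0 = v * u" "d ?t 0 = u" "P (?t + n) 0 = v * u" "d (?t + n) 0 = u"
      using queue_no_switch_0[OF _ ns, of "?t"] queue_no_switch_0[OF _ ns, of "?t + n"] u
      by (simp_all add: P_def d_def u_def v_def)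
    show ?case unfolding eq
    proof (intro allI impI)
      fix j assume j: "j \<le> n"
      show "d (?t + n) j \<le> (real (Suc k) + C) * u \<and>
        \<bar>P (?t + n) j - v * d (?t + n) j\<bar> \<le> E * C / (real (Suc k) + C) * d (?t + n) j"
      proof (cases "j = 0")
        case True
        then show ?thesis using P0 u C M0 by (auto simp: E_def)
      next
        case False
        define D where "D = d ?t j"
        define r where "r = P ?t j - v * D"
        have D: "0 < D" "D \<le> (real k + C) * u" and r: "\<bar>r\<bar> \<le> E * C / (real k + C) * D"
          using Suc d_pos j by (auto simp: D_def r_def)
        have new: "d (?t + n) j = c * (u + D)" "P (?t + n) j - v * d (?t + n) j = c * r"
          using queue_no_switch_round[OF ns', of j n c] False j P0
          by (simp_all add: P_def d_def D_def r_def algebra_simps)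
        have "c * (u + D) \<le> 1 * (u + D)" using c01 u D by (intro mult_right_mono) auto
        also have "\<dots> \<le> (real (Suc k) + C) * u" using D by (simp add: algebra_simps)
        finally have 1: "d (?t + n) j \<le> (real (Suc k) + C) * u" using new by simp
        \<comment> \<open>This is the linear growth bound on \<open>D\<close> rearranged; it is what
          advances the harmonic factor from \<open>k\<close> to \<open>Suc k\<close>.\<close>
        have "D * (real (Suc k) + C) \<le> (real k + C) * (u + D)" using D by (simp add: algebra_simps)
        then have "1 / (real k + C) * D \<le> 1 / (real (Suc k) + C) * (u + D)"
          using k0 by (simp add: divide_simps mult.commute)
        then have "(E * C) * (1 / (real k + C) * D) \<le> (E * C) * (1 / (real (Suc k) + C) * (u + D))"
          using M0 C by (intro mult_left_mono) (auto simp: E_def)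
        then have "\<bar>r\<bar> \<le> E * C / (real (Suc k) + C) * (u + D)" using r by simp
        then have "c * \<bar>r\<bar> \<le> c * (E * C / (real (Suc k) + C) * (u + D))"
          using c01 by (intro mult_left_mono) auto
        then have 2: "\<bar>P (?t + n) j - v * d (?t + n) j\<bar> \<le> E * C / (real (Suc k) + C) * d (?t + n) j"
          unfolding new(2) unfolding new(1) using c01 by (simp add: abs_mult mult.left_commute)
        show ?thesis using 1 2 by simp
      qed
    qed
  qed
  obtain k where k: "2 * E * C / e < real k" using reals_Archimedean2 by blast
  define b where "b = E * C / (real k + C)"
  have "2 * E * C \<le> e * (real k + C)" using k \<open>0 < e\<close> C
    by (simp add: divide_simps) (smt (verit) mult.commute mult_left_mono)
  then have "2 * b \<le> e" using C by (simp add: b_def divide_simps)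
  moreover have "ratios_in (s + k * n) (v - b) (v + b)"
    using main[of k] unfolding ratios_in_def b_def by (fastforce simp: algebra_simps abs_le_iff)
  ultimately show ?thesis
    by (intro exI[of _ "s + k * n"] exI[of _ "v - b"] exI[of _ "v + b"]) simp
qed

text \<open>Either the reserve is eventually fixed and convergence is harmonic, or switches recur
  forever and permit arbitrarily many contractions by \<open>1 - \<theta>\<close>.\<close>

theorem shrink:
  assumes "0 < e"
  shows "\<exists>t A B. B - A \<le> e \<and> ratios_in t A B"
proof (cases "\<exists>s. \<forall>t\<ge>s. \<not> a t")
  case True then show ?thesis using no_switch_shrink assms by blast
next
  case False
  define K where "K = 2 * (\<Sum>j\<le>n. \<bar>p j\<bar>)"
  have "\<exists>t A B. B - A = (1 - \<theta>) ^ m * K \<and> ratios_in t A B" for m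
  proof (induction m)
    case 0 show ?case
      by (intro exI[of _ 0] exI[of _ "- (\<Sum>j\<le>n. \<bar>p j\<bar>)"] exI[of _ "\<Sum>j\<le>n. \<bar>p j\<bar>"])
        (simp add: K_def ratios_in_initial)
  next
    case (Suc m)
    then obtain t A B where *: "B - A = (1 - \<theta>) ^ m * K" "ratios_in t A B" by blast
    obtain s where "s \<ge> t" "a s" using False by blast
    then have "ratios_in (Suc s) A B" using * ratios_in_later by simp
    then obtain A' B' where "B' - A' = (1 - \<theta>) * (B - A)" "ratios_in (Suc s + n * (n + 2)) A' B'"
      using switch_contraction[OF \<open>a s\<close>] by blast
    then show ?case using * by (metis mult.assoc power_Suc)
  qed
  moreover have "\<exists>m. (1 - \<theta>) ^ m * K \<le> e"
  proof -
    have "(\<lambda>m. (1 - \<theta>) ^ m * K) \<longlonglongrightarrow> 0 * K"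
      using \<theta>_bounds by (intro tendsto_mult tendsto_const LIMSEQ_realpow_zero) auto
    then have "eventually (\<lambda>m. (1 - \<theta>) ^ m * K < e) sequentially"
      using assms by (intro order_tendstoD(2)) auto
    then show ?thesis by (auto simp: eventually_sequentially intro: less_imp_le)
  qed
  ultimately show ?thesis by metis
qed

end

subsection \<open>The maps in barycentric coordinates\<close>

text \<open>The coordinate with index \<open>j\<close> belongs to column \<open>j\<close> of \<open>V\<close>, so index 0 is the origin and index
  \<open>j \<ge> 1\<close> the vertex with \<open>n + 1 - j\<close> leading ones.\<close>
definition bary :: "nat \<Rightarrow> (nat \<Rightarrow> real) \<Rightarrow> nat \<Rightarrow> real" where
  "bary n x j = (if j = 0 then 1 - x 0 else x (n - j) - x (n + 1 - j))"

text \<open>The point with barycentric weights proportional to \<open>y\<close>: coordinate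
  \<open>i\<close> collects the weights of the vertices with more than \<open>i\<close> leading
  ones.\<close>

definition pt :: "nat \<Rightarrow> (nat \<Rightarrow> real) \<Rightarrow> nat \<Rightarrow> real" where
  "pt n y i = (if i < n then (\<Sum>j=1..n - i. y j) / (\<Sum>j\<le>n. y j) else 0)"

lemma sum_bary: "k \<le> n \<Longrightarrow> x n = 0 \<Longrightarrow> (\<Sum>j=1..k. bary n x j) = x (n - k)"
  by (induction k) (auto simp: bary_def)

lemma sum_atMost_head: "(\<Sum>j\<le>n. y j) = y 0 + (\<Sum>j=1..n. y j)" for y :: "nat \<Rightarrow> real"
  by (simp add: atLeast0AtMost[symmetric] sum.atLeast_Suc_atMost)

lemma sum_bary_all: "x n = 0 \<Longrightarrow> (\<Sum>j\<le>n. bary n x j) = 1"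
  unfolding sum_atMost_head by (simp only: sum_bary) (simp add: bary_def)

lemma pt_bary: "\<forall>i\<ge>n. x i = 0 \<Longrightarrow> pt n (bary n x) = x"
proof (rule ext)
  fix i assume x: "\<forall>i\<ge>n. x i = 0"
  then have "(\<Sum>j=1..n - i. bary n x j) = x (n - (n - i))" "(\<Sum>j\<le>n. bary n x j) = 1"
    using sum_bary[of "n - i" n x] sum_bary_all[of x n] by simp_all
  then show "pt n (bary n x) i = x i" using x by (simp add: pt_def)
qed

lemma pt_zero: "i \<ge> n \<Longrightarrow> pt n y i = 0"
  by (simp add: pt_def)

lemma pt_cong: "(\<And>j. j \<le> n \<Longrightarrow> y j = z j) \<Longrightarrow> pt n y = pt n z"
  by (auto simp: pt_def intro!: ext arg_cong2[where f = "(/)"] sum.cong)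

lemma pt_scale: "k \<noteq> 0 \<Longrightarrow> pt n (\<lambda>j. k * y j) = pt n y"
  by (auto simp: pt_def sum_distrib_left[symmetric])

lemma bary_pt:
  assumes "1 \<le> n" "(\<Sum>j\<le>n. y j) \<noteq> 0" "j \<le> n"
  shows "bary n (pt n y) j = y j / (\<Sum>j\<le>n. y j)"
proof (cases "j = 0")
  case True
  have "1 - (\<Sum>j=1..n. y j) / (\<Sum>j\<le>n. y j) = ((\<Sum>j\<le>n. y j) - (\<Sum>j=1..n. y j)) / (\<Sum>j\<le>n. y j)"
    using assms(2) by (simp add: diff_divide_distrib)
  also have "(\<Sum>j\<le>n. y j) - (\<Sum>j=1..n. y j) = y 0" by (simp add: sum_atMost_head)
  finally show ?thesis using True assms by (simp add: bary_def pt_def)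
next
  case False
  then obtain i where i: "j = Suc i" by (cases j) auto
  then have "n - (n - Suc i) = Suc i" "n - (Suc n - Suc i) = i" using assms by auto
  then show ?thesis using i assms(3) by (auto simp: bary_def pt_def add_divide_distrib)
qed

lemma bary_inject:
  assumes "\<forall>i\<ge>n. x i = 0" "\<forall>i\<ge>n. x' i = 0" "\<And>j. j \<le> n \<Longrightarrow> bary n x j = bary n x' j"
  shows "x = x'"
proof -
  have "pt n (bary n x) = pt n (bary n x')" by (rule pt_cong) (rule assms(3))
  then show ?thesis using pt_bary[OF assms(1)] pt_bary[OF assms(2)] by simp
qed

section \<open>The matrices acting on barycentric coordinates\<close>

lemma mat_V_mult:
  assumes "y \<in> carrier_vec (n + 1)" "i \<le> n"
  shows "vec_index (mat_V n *\<^sub>v y) i =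
    (if i < n then \<Sum>j=1..n - i. vec_index y j else \<Sum>j\<le>n. vec_index y j)"
proof -
  have "vec_index (mat_V n *\<^sub>v y) i = (\<Sum>j\<le>n. (if i = n \<or> (1 \<le> j \<and> i + j \<le> n) then 1 else 0) * vec_index y j)"
    using assms by (auto simp: mat_V_def square_mat_def scalar_prod_def atLeast0LessThan lessThan_Suc_atMost
      intro!: sum.cong)
  also have "\<dots> = (\<Sum>j\<in>{j. j \<le> n \<and> (i = n \<or> (1 \<le> j \<and> i + j \<le> n))}. vec_index y j)"
    by (rule sum.mono_neutral_cong_right) auto
  also have "{j. j \<le> n \<and> (i = n \<or> (1 \<le> j \<and> i + j \<le> n))} = (if i < n then {1..n - i} else {..n})"
    using assms(2) by auto
  finally show ?thesis by simp
qed

lemma mat_V_mult_vec: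
  "i \<le> n \<Longrightarrow> vec_index (mat_V n *\<^sub>v Matrix.vec (n + 1) y) i =
    (if i < n then \<Sum>j=1..n - i. y j else \<Sum>j\<le>n. y j)"
  by (subst mat_V_mult) (auto intro!: sum.cong)

lemma mat_V_carrier: "mat_V n \<in> carrier_mat (n + 1) (n + 1)"
  by (simp add: mat_V_def square_mat_def)

lemma mat_AB_carrier: "mat_AB n c a \<in> carrier_mat (n + 1) (n + 1)"
  by (simp add: mat_AB_def square_mat_def)

lemma proj_point_mat_V:
  assumes "y \<in> carrier_vec (n + 1)"
  shows "proj_point n (mat_V n *\<^sub>v y) = pt n (vec_index y)"
  using mat_V_mult[OF assms] by (auto simp: proj_point_def pt_def)

text \<open>Multiplication by \<open>A\<close> (for \<open>c = 1\<close>) or \<open>B\<close> (for \<open>c = 1 / 2\<close>).\<close>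
definition act :: "nat \<Rightarrow> real \<Rightarrow> bool \<Rightarrow> (nat \<Rightarrow> real) \<Rightarrow> nat \<Rightarrow> real" where
  "act n c a y k =
     (if k = 0 then (if a then 0 else y 0) + c * y n
      else if k = 1 then (if a then y 0 else 0) + c * y n
      else y (k - 1))"

text \<open>The inverse of \<open>act\<close> for whichever branch makes the result nonnegative.\<close>
definition folded :: "nat \<Rightarrow> real \<Rightarrow> (nat \<Rightarrow> real) \<Rightarrow> nat \<Rightarrow> real" where
  "folded n c b j = (if j = 0 then \<bar>b 0 - b 1\<bar> else if j = n then min (b 0) (b 1) / c else b (Suc j))"

lemma act_folded:
  assumes "1 \<le> n" "c \<noteq> 0" "if a then b 0 \<le> b 1 else b 1 \<le> b 0" "k \<le> n"
  shows "act n c a (folded n c b) k = b k"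
  using assms by (auto simp: act_def folded_def min_def split: if_splits)

lemma mat_AB_entry:
  assumes "1 \<le> n" "k \<le> n" "j \<le> n"
  shows "mat_AB n c a $$ (k, j) = act n c a (\<lambda>i. if i = j then 1 else 0) k"
  using assms by (auto simp: mat_AB_def square_mat_def act_def)

lemma act_expand:
  assumes "1 \<le> n" "k \<le> n"
  shows "act n c a y k = (\<Sum>j\<le>n. act n c a (\<lambda>i. if i = j then 1 else 0) k * y j)"
proof -
  have "act n c a (\<lambda>i. if i = j then 1 else 0) k * y j =
    (if k \<le> 1 then (if j = 0 then (if a = (k = 1) then y 0 else 0) else 0) + (if j = n then c * y n else 0)
     else if j = k - 1 then y (k - 1) else 0)" if "j \<le> n" for j
    using assms that by (auto simp: act_def)
  then have "(\<Sum>j\<le>n. act n c a (\<lambda>i. if i = j then 1 else 0) k * y j) =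
    (\<Sum>j\<le>n. if k \<le> 1 then (if j = 0 then (if a = (k = 1) then y 0 else 0) else 0) + (if j = n then c * y n else 0)
     else if j = k - 1 then y (k - 1) else 0)"
    by (intro sum.cong) auto
  also have "\<dots> = act n c a y k"
    using assms by (cases "k \<le> 1") (auto simp: act_def sum.distrib)
  finally show ?thesis by simp
qed

lemma mat_AB_mult:
  assumes "1 \<le> n" "y \<in> carrier_vec (n + 1)" "k \<le> n"
  shows "vec_index (mat_AB n c a *\<^sub>v y) k = act n c a (vec_index y) k"
proof -
  have "vec_index (mat_AB n c a *\<^sub>v y) k = (\<Sum>j\<le>n. mat_AB n c a $$ (k, j) * vec_index y j)"
    using assms mat_AB_carrier[of n c a]
    by (auto simp: scalar_prod_def atLeast0LessThan lessThan_Suc_atMost)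
  also have "\<dots> = act n c a (vec_index y) k"
    unfolding act_expand[OF assms(1,3), of c a "vec_index y"] using mat_AB_entry[OF assms(1,3)] by (intro sum.cong) auto
  finally show ?thesis .
qed

text \<open>Injectivity makes the determinant nonzero, so elimination returns an inverse; none of
  its entries has to be computed.\<close>

lemma inv_mat_left:
  assumes P: "P \<in> carrier_mat m m" and inj: "\<And>v. v \<in> carrier_vec m \<Longrightarrow> P *\<^sub>v v = 0\<^sub>v m \<Longrightarrow> v = 0\<^sub>v m"
  shows "inv_mat P \<in> carrier_mat m m" "inv_mat P * P = 1\<^sub>m m"
proof -
  have "Determinant.det P \<noteq> 0" using det_0_iff_vec_prod_zero_field[OF P] inj by blast
  then have "P \<in> Units (ring_mat TYPE(real) m ())" by (rule det_non_zero_imp_unit[OF P])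
  then obtain Q where Q: "mat_inverse P = Some Q" using mat_inverse(1)[OF P, where b = "()"] by (cases "mat_inverse P") blast+
  then show "inv_mat P \<in> carrier_mat m m" "inv_mat P * P = 1\<^sub>m m"
    using mat_inverse(2)[OF P Q] by (auto simp: inv_mat_def)
qed

text \<open>The rows of \<open>V\<close> form partial sums, and differences of these recover the
  entries.\<close>

lemma mat_V_inj:
  assumes "v \<in> carrier_vec (n + 1)" "mat_V n *\<^sub>v v = 0\<^sub>v (n + 1)"
  shows "v = 0\<^sub>v (n + 1)"
proof -
  have 0: "vec_index (mat_V n *\<^sub>v v) i = 0" if "i \<le> n" for i
    using that unfolding assms(2) by simp
  have S: "(\<Sum>j=1..k. vec_index v j) = 0" if "k \<le> n" for k
    using 0[of "n - k"] mat_V_mult[OF assms(1), of "n - k"] that by (cases "k = 0") auto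
  have "vec_index v j = 0" if "j \<le> n" for j
  proof (cases j)
    case 0
    then show ?thesis using \<open>\<And>i. i \<le> n \<Longrightarrow> vec_index (mat_V n *\<^sub>v v) i = 0\<close>[of n]
        mat_V_mult[OF assms(1), of n] S[of n] sum_atMost_head[of "vec_index v" n] by simp
  next
    case (Suc i)
    then show ?thesis using S[of i] S[of j] that by simp
  qed
  then show ?thesis using assms(1) by (intro eq_vecI) auto
qed

lemma mat_AB_inj:
  assumes "1 \<le> n" "c \<noteq> 0" "v \<in> carrier_vec (n + 1)" "mat_AB n c a *\<^sub>v v = 0\<^sub>v (n + 1)"
  shows "v = 0\<^sub>v (n + 1)"
proof -
  have 0: "act n c a (vec_index v) k = 0" if "k \<le> n" for k
    using mat_AB_mult[OF assms(1,3) that, of c a] that unfolding assms(4) by simp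
  have n: "vec_index v n = 0" and h: "vec_index v 0 = 0"
    using 0[of 0] 0[of 1] assms(1,2) by (auto simp: act_def split: if_splits)
  have "vec_index v j = 0" if "j \<le> n" for j
    using 0[of "Suc j"] n h that by (cases "j = 0 \<or> j = n") (auto simp: act_def)
  then show ?thesis using assms(3) by (intro eq_vecI) auto
qed

lemma conjugated_inverse_mult:
  assumes n: "1 \<le> n" and c: "c \<noteq> 0" and z: "z \<in> carrier_vec (n + 1)"
  shows "(mat_V n * inv_mat (mat_AB n c a) * inv_mat (mat_V n)) *\<^sub>v (mat_V n *\<^sub>v (mat_AB n c a *\<^sub>v z))
    = mat_V n *\<^sub>v z"
proof -
  let ?V = "mat_V n" and ?A = "mat_AB n c a"
  note V = mat_V_carrier[of n] inv_mat_left[OF mat_V_carrier mat_V_inj]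
  note A = mat_AB_carrier[of n c a] inv_mat_left[OF mat_AB_carrier mat_AB_inj[OF n c]]
  have Az: "?A *\<^sub>v z \<in> carrier_vec (n + 1)" using A z by simp
  then have VAz: "?V *\<^sub>v (?A *\<^sub>v z) \<in> carrier_vec (n + 1)" using V by simp
  have "(?V * inv_mat ?A * inv_mat ?V) *\<^sub>v (?V *\<^sub>v (?A *\<^sub>v z))
    = (?V * inv_mat ?A) *\<^sub>v (inv_mat ?V *\<^sub>v (?V *\<^sub>v (?A *\<^sub>v z)))"
    using A V VAz by (intro assoc_mult_mat_vec[of _ "n + 1" "n + 1" _ "n + 1"]) auto
  also have "inv_mat ?V *\<^sub>v (?V *\<^sub>v (?A *\<^sub>v z)) = (inv_mat ?V * ?V) *\<^sub>v (?A *\<^sub>v z)"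
    using V Az by (intro assoc_mult_mat_vec[symmetric]) auto
  also have "\<dots> = ?A *\<^sub>v z" using V Az by simp
  also have "(?V * inv_mat ?A) *\<^sub>v (?A *\<^sub>v z) = ?V *\<^sub>v (inv_mat ?A *\<^sub>v (?A *\<^sub>v z))"
    using A V Az by (intro assoc_mult_mat_vec) auto
  also have "inv_mat ?A *\<^sub>v (?A *\<^sub>v z) = (inv_mat ?A * ?A) *\<^sub>v z"
    using A z by (intro assoc_mult_mat_vec[symmetric]) auto
  also have "\<dots> = z" using A z by simp
  finally show ?thesis .
qed

lemma homog_eq:
  assumes "\<forall>i\<ge>n. x i = 0"
  shows "homog n x = mat_V n *\<^sub>v Matrix.vec (n + 1) (bary n x)"
proof (rule eq_vecI)
  show "dim_vec (homog n x) = dim_vec (mat_V n *\<^sub>v Matrix.vec (n + 1) (bary n x))"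
    by (simp add: homog_def mat_V_def square_mat_def)
  fix i assume "i < dim_vec (mat_V n *\<^sub>v Matrix.vec (n + 1) (bary n x))"
  then have i: "i \<le> n" by (simp add: mat_V_def square_mat_def)
  have "vec_index (mat_V n *\<^sub>v Matrix.vec (n + 1) (bary n x)) i
    = (if i < n then \<Sum>j=1..n - i. bary n x j else \<Sum>j\<le>n. bary n x j)"
    by (rule mat_V_mult_vec[OF i])
  also have "\<dots> = (if i < n then x i else 1)"
    using sum_bary[of "n - i" n x] sum_bary_all[of x n] assms by simp
  finally show "vec_index (homog n x) i = vec_index (mat_V n *\<^sub>v Matrix.vec (n + 1) (bary n x)) i"
    using i by (simp add: homog_def)
qed

text \<open>Conjugation by \<open>V\<close> passes to barycentric coordinates, where the branch is
  the inverse of \<open>act\<close>; for the digit given by the order of the first two coordinates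
  this inverse is \<open>folded\<close>.\<close>

lemma branch_mult_homog:
  assumes n: "1 \<le> n" and c: "c \<noteq> 0" and x: "\<forall>i\<ge>n. x i = 0" and a: "a \<longleftrightarrow> bary n x 0 < bary n x 1"
  shows "(mat_V n * inv_mat (mat_AB n c a) * inv_mat (mat_V n)) *\<^sub>v homog n x
    = mat_V n *\<^sub>v Matrix.vec (n + 1) (folded n c (bary n x))"
proof -
  have "mat_AB n c a *\<^sub>v Matrix.vec (n + 1) (folded n c (bary n x)) = Matrix.vec (n + 1) (bary n x)"
  proof (rule eq_vecI)
    fix i assume "i < dim_vec (Matrix.vec (n + 1) (bary n x))"
    then have i: "i \<le> n" by simp
    have "act n c a (vec_index (Matrix.vec (n + 1) (folded n c (bary n x)))) i = act n c a (folded n c (bary n x)) i"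
      using n i by (auto simp: act_def)
    then show "vec_index (mat_AB n c a *\<^sub>v Matrix.vec (n + 1) (folded n c (bary n x))) i
      = vec_index (Matrix.vec (n + 1) (bary n x)) i"
      using mat_AB_mult[OF n, of "Matrix.vec (n + 1) (folded n c (bary n x))" i c a] act_folded[OF n c _ i, of a "bary n x"] a i by auto
  qed (simp add: mat_AB_def square_mat_def)
  then show ?thesis
    using conjugated_inverse_mult[OF n c, of "Matrix.vec (n + 1) (folded n c (bary n x))" a] homog_eq[OF x] by simp
qed

section \<open>Simplices spanned by matrix columns\<close>

lemma bary_convex_combination:
  assumes "(\<Sum>j\<le>n. y j) = 1"
  shows "bary n (\<lambda>i. \<Sum>j\<le>n. q j i * y j) k = (\<Sum>j\<le>n. bary n (q j) k * y j)"
  using assms by (auto simp: bary_def left_diff_distrib sum_subtractf)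

text \<open>The vertices have the normalised columns of \<open>Q\<close> as barycentric coordinates,
  and \<open>bary\<close> commutes with convex combinations.\<close>

lemma mem_column_simplex:
  assumes n: "1 \<le> n" and Q: "Q \<in> carrier_mat (n + 1) (n + 1)"
    and pos: "\<And>j. j \<le> n \<Longrightarrow> (\<Sum>k\<le>n. Q $$ (k, j)) \<noteq> 0"
  shows "x \<in> column_simplex n (mat_V n * Q) \<longleftrightarrow> (\<forall>i\<ge>n. x i = 0) \<and>
    (\<exists>y\<in>standard_simplex n. \<forall>k\<le>n. bary n x k = (\<Sum>j\<le>n. Q $$ (k, j) / (\<Sum>k\<le>n. Q $$ (k, j)) * y j))"
    (is "?L \<longleftrightarrow> ?E \<and> (\<exists>y\<in>_. ?R y)")
proof -
  define q where "q j = proj_point n (col (mat_V n * Q) j)" for j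
  have q: "q j = pt n (\<lambda>k. Q $$ (k, j))" if "j \<le> n" for j
  proof -
    have "col (mat_V n * Q) j = mat_V n *\<^sub>v col Q j"
      using mat_V_carrier[of n] Q that by (intro col_mult2[of _ "n + 1" "n + 1" _ "n + 1"]) auto
    then have "q j = pt n (vec_index (col Q j))"
      unfolding q_def using proj_point_mat_V[of "col Q j" n] Q by (simp add: carrier_vecI)
    also have "\<dots> = pt n (\<lambda>k. Q $$ (k, j))"
      by (rule pt_cong) (use Q that in auto)
    finally show ?thesis .
  qed
  define comb where "comb y = (\<lambda>i. \<Sum>j\<le>n. q j i * y j)" for y
  have comb0: "\<forall>i\<ge>n. comb y i = 0" for y
    unfolding comb_def q_def by (simp add: proj_point_def)
  have comb_bary: "bary n (comb y) k = (\<Sum>j\<le>n. Q $$ (k, j) / (\<Sum>k\<le>n. Q $$ (k, j)) * y j)"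
    if "y \<in> standard_simplex n" "k \<le> n" for y k
  proof -
    have "bary n (comb y) k = (\<Sum>j\<le>n. bary n (q j) k * y j)"
      unfolding comb_def by (rule bary_convex_combination) (use that in \<open>auto simp: standard_simplex_def\<close>)
    also have "\<dots> = (\<Sum>j\<le>n. Q $$ (k, j) / (\<Sum>k\<le>n. Q $$ (k, j)) * y j)"
      by (rule sum.cong) (use q bary_pt[OF n] pos that in auto)
    finally show ?thesis .
  qed
  have "?L \<longleftrightarrow> (\<exists>y\<in>standard_simplex n. x = comb y)"
    unfolding column_simplex_def oriented_simplex_def q_def comb_def by (auto simp: image_iff)
  also have "\<dots> \<longleftrightarrow> (\<exists>y\<in>standard_simplex n. ?E \<and> ?R y)"
  proof (rule bex_cong[OF refl])
    fix y assume y: "y \<in> standard_simplex n"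
    show "x = comb y \<longleftrightarrow> ?E \<and> ?R y"
    proof
      assume "x = comb y" then show "?E \<and> ?R y" using comb0 comb_bary[OF y] by simp
    next
      assume "?E \<and> ?R y" then show "x = comb y"
        by (intro bary_inject[of n]) (use comb0 comb_bary[OF y] in auto)
    qed
  qed
  finally show ?thesis by blast
qed

lemma standard_simplexI:
  assumes "\<And>j. j \<le> n \<Longrightarrow> 0 \<le> y j" "(\<Sum>j\<le>n. y j) = 1"
  shows "(\<lambda>j. if j \<le> n then y j else 0) \<in> standard_simplex n"
proof -
  have "y j \<le> 1" if "j \<le> n" for j
    using member_le_sum[of j "{..n}" y] assms that by auto
  then show ?thesis using assms by (auto simp: standard_simplex_def)
qed

lemma Delta_eq:
  assumes n: "1 \<le> n"
  shows "Delta n = {x. (\<forall>i\<ge>n. x i = 0) \<and> (\<forall>j\<le>n. 0 \<le> bary n x j)}"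
proof -
  have V1: "mat_V n = mat_V n * 1\<^sub>m (n + 1)" using right_mult_one_mat[OF mat_V_carrier[of n]] by simp
  have one: "(\<Sum>k\<le>n. (1\<^sub>m (n + 1) :: real mat) $$ (k, j)) = 1" if "j \<le> n" for j
    using that by (simp add: if_distrib sum.If_cases)
  have mem: "x \<in> Delta n \<longleftrightarrow> (\<forall>i\<ge>n. x i = 0) \<and> (\<exists>y\<in>standard_simplex n. \<forall>k\<le>n. bary n x k = y k)" for x
  proof -
    define F where "F k y = (\<Sum>j\<le>n. (1\<^sub>m (n + 1) :: real mat) $$ (k, j) / (\<Sum>k\<le>n. (1\<^sub>m (n + 1) :: real mat) $$ (k, j)) * y j)"
      for k y
    have F: "F k y = y k" if "k \<le> n" for k y
    proof -
      have "F k y = (\<Sum>j\<le>n. if j = k then y k else 0)"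
        unfolding F_def using one that by (intro sum.cong) auto
      then show ?thesis using that by simp
    qed
    have "x \<in> Delta n \<longleftrightarrow> (\<forall>i\<ge>n. x i = 0) \<and> (\<exists>y\<in>standard_simplex n. \<forall>k\<le>n. bary n x k = F k y)"
      unfolding Delta_def F_def by (subst V1, rule mem_column_simplex[OF n one_carrier_mat]) (simp add: one)
    then show ?thesis by (simp add: F)
  qed
  have nonneg: "(\<exists>y\<in>standard_simplex n. \<forall>k\<le>n. bary n x k = y k) \<longleftrightarrow> (\<forall>j\<le>n. 0 \<le> bary n x j)"
    if "\<forall>i\<ge>n. x i = 0" for x
  proof
    assume "\<exists>y\<in>standard_simplex n. \<forall>k\<le>n. bary n x k = y k"
    then show "\<forall>j\<le>n. 0 \<le> bary n x j" by (auto simp: standard_simplex_def)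
  next
    assume "\<forall>j\<le>n. 0 \<le> bary n x j"
    then show "\<exists>y\<in>standard_simplex n. \<forall>k\<le>n. bary n x k = y k"
      using standard_simplexI[of n "bary n x"] sum_bary_all[of x n] that
      by (intro bexI[of _ "\<lambda>j. if j \<le> n then bary n x j else 0"]) auto
  qed
  show ?thesis
  proof (rule Set.set_eqI)
    fix x show "x \<in> Delta n \<longleftrightarrow> x \<in> {x. (\<forall>i\<ge>n. x i = 0) \<and> (\<forall>j\<le>n. 0 \<le> bary n x j)}"
      using mem[of x] nonneg[of x] by (simp only: mem_Collect_eq) blast
  qed
qed

lemma sum_act:
  assumes "1 \<le> n"
  shows "(\<Sum>k\<le>n. act n c a y k) = (\<Sum>j<n. y j) + 2 * c * y n"
proof -
  obtain m where m: "n = Suc m" using assms by (cases n) auto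
  have "(\<Sum>k\<le>n. act n c a y k) = act n c a y 0 + act n c a y 1 + (\<Sum>k<m. act n c a y (Suc (Suc k)))"
    unfolding m by (simp only: sum.atMost_Suc_shift lessThan_Suc_atMost[symmetric] sum.lessThan_Suc_shift) simp
  also have "\<dots> = (\<Sum>j<n. y j) + 2 * c * y n"
    unfolding m sum.lessThan_Suc_shift by (auto simp: act_def m)
  finally show ?thesis .
qed

lemma Delta_sub_eq:
  assumes n: "1 \<le> n"
  shows "Delta_sub n a = {x \<in> Delta n. if a then bary n x 0 \<le> bary n x 1 else bary n x 1 \<le> bary n x 0}"
proof -
  \<comment> \<open>Only the last column of \<open>A\<close> has sum 2, so normalising the columns
    turns \<open>A\<close> into \<open>B\<close>. This is why \<open>1/2\<close> describes the
    halves for both maps.\<close>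
  have s: "(\<Sum>k\<le>n. mat_AB n 1 a $$ (k, j)) = (if j = n then 2 else 1)" if "j \<le> n" for j
    using mat_AB_entry[OF n, of _ j 1 a] sum_act[OF n, of 1 a "\<lambda>i. if i = j then 1 else 0"] that by simp
  have half: "(\<Sum>j\<le>n. mat_AB n 1 a $$ (k, j) / (\<Sum>k\<le>n. mat_AB n 1 a $$ (k, j)) * y j) = act n (1/2) a y k"
    if "k \<le> n" for k y
    unfolding act_expand[OF n that, of "1/2" a y]
  proof (rule sum.cong[OF refl])
    fix j assume "j \<in> {..n}"
    then have j: "j \<le> n" by simp
    show "mat_AB n 1 a $$ (k, j) / (\<Sum>k\<le>n. mat_AB n 1 a $$ (k, j)) * y j =
      act n (1/2) a (\<lambda>i. if i = j then 1 else 0) k * y j"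
      unfolding mat_AB_entry[OF n that j] s[OF j] using n that by (auto simp: act_def)
  qed
  have mem: "x \<in> Delta_sub n a \<longleftrightarrow> (\<forall>i\<ge>n. x i = 0) \<and> (\<exists>y\<in>standard_simplex n. \<forall>k\<le>n. bary n x k = act n (1/2) a y k)" for x
  proof -
    define F where "F k y = (\<Sum>j\<le>n. mat_AB n 1 a $$ (k, j) / (\<Sum>k\<le>n. mat_AB n 1 a $$ (k, j)) * y j)" for k y
    have F: "F k y = act n (1/2) a y k" if "k \<le> n" for k y
      unfolding F_def by (rule half[OF that])
    have "x \<in> Delta_sub n a \<longleftrightarrow> (\<forall>i\<ge>n. x i = 0) \<and> (\<exists>y\<in>standard_simplex n. \<forall>k\<le>n. bary n x k = F k y)"
      unfolding Delta_sub_def mat_A_def F_def by (rule mem_column_simplex[OF n mat_AB_carrier]) (simp add: s)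
    then show ?thesis by (simp add: F)
  qed
  show ?thesis
  proof (intro Set.set_eqI iffI)
    fix x assume "x \<in> Delta_sub n a"
    then have "(\<forall>i\<ge>n. x i = 0) \<and> (\<exists>y\<in>standard_simplex n. \<forall>k\<le>n. bary n x k = act n (1/2) a y k)"
      by (rule iffD1[OF mem])
    then obtain y where x: "\<forall>i\<ge>n. x i = 0" "\<And>k. k \<le> n \<Longrightarrow> bary n x k = act n (1/2) a y k"
      and y: "y \<in> standard_simplex n" by blast
    have y0: "0 \<le> y j" for j using y by (simp add: standard_simplex_def)
    have "0 \<le> bary n x k" if "k \<le> n" for k using x(2)[OF that] y0 by (simp add: act_def)
    moreover have "if a then bary n x 0 \<le> bary n x 1 else bary n x 1 \<le> bary n x 0"
      using x(2)[of 0] x(2)[of 1] n y0 by (simp add: act_def)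
    ultimately show "x \<in> {x \<in> Delta n. if a then bary n x 0 \<le> bary n x 1 else bary n x 1 \<le> bary n x 0}"
      using x by (simp add: Delta_eq[OF n])
  next
    fix x assume "x \<in> {x \<in> Delta n. if a then bary n x 0 \<le> bary n x 1 else bary n x 1 \<le> bary n x 0}"
    then have x: "\<forall>i\<ge>n. x i = 0" "\<And>j. j \<le> n \<Longrightarrow> 0 \<le> bary n x j"
      and ord: "if a then bary n x 0 \<le> bary n x 1 else bary n x 1 \<le> bary n x 0"
      by (auto simp: Delta_eq[OF n])
    \<comment> \<open>The weights of \<open>x\<close> with respect to the vertices of its half come
      from inverting \<open>act\<close> for \<open>1/2\<close>.\<close>
    define y where "y = folded n (1/2) (bary n x)"
    have act: "bary n x k = act n (1/2) a y k" if "k \<le> n" for k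
    proof -
      have "y 0 = \<bar>bary n x 0 - bary n x 1\<bar>" "y n = 2 * min (bary n x 0) (bary n x 1)"
        "2 \<le> k \<Longrightarrow> y (k - 1) = bary n x k"
        using n that by (auto simp: y_def folded_def)
      then show ?thesis using ord by (auto simp: act_def)
    qed
    have y0: "0 \<le> y j" if "j \<le> n" for j
    proof -
      have "j < n \<Longrightarrow> 0 \<le> bary n x (Suc j)" "0 \<le> min (bary n x 0) (bary n x 1)"
        using x(2)[of 0] x(2)[of 1] x(2)[of "Suc j"] n by auto
      then show ?thesis using that by (simp add: y_def folded_def)
    qed
    have "(\<Sum>j\<le>n. y j) = (\<Sum>k\<le>n. act n (1/2) a y k)"
      using sum_act[OF n, of "1/2" a y] by (simp add: lessThan_Suc_atMost[symmetric])
    also have "\<dots> = 1" using sum_bary_all[of x n] act x(1) by simp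
    finally have "(\<lambda>j. if j \<le> n then y j else 0) \<in> standard_simplex n"
      using y0 by (intro standard_simplexI) auto
    moreover have "\<forall>k\<le>n. bary n x k = act n (1/2) a (\<lambda>j. if j \<le> n then y j else 0) k"
      using act n by (auto simp: act_def)
    ultimately show "x \<in> Delta_sub n a" unfolding mem using x(1) by blast
  qed
qed

section \<open>Both maps as normalised foldings\<close>

definition step :: "nat \<Rightarrow> real \<Rightarrow> (nat \<Rightarrow> real) \<Rightarrow> nat \<Rightarrow> real" where
  "step n c x = pt n (folded n c (bary n x))"

text \<open>The column of \<open>act\<close> for the last entry has sum \<open>2 * c\<close>, the
  others have sum 1. For \<open>c = 1 / 2\<close> the total therefore stays 1, and the tent map is
  affine on each half.\<close>

lemma sum_folded:
  assumes "1 \<le> n" "c \<noteq> 0" "x n = 0"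
  shows "(\<Sum>j\<le>n. folded n c (bary n x) j) = 1 - (2 - 1 / c) * min (bary n x 0) (bary n x 1)"
proof -
  define a where "a \<longleftrightarrow> bary n x 0 < bary n x 1"
  have "1 = (\<Sum>k\<le>n. act n c a (folded n c (bary n x)) k)"
    using sum_bary_all[of x n] act_folded[OF assms(1,2), of a "bary n x"] a_def assms(3) by simp
  also have "\<dots> = (\<Sum>j\<le>n. folded n c (bary n x) j) + (2 * c - 1) * folded n c (bary n x) n"
    unfolding sum_act[OF assms(1)] by (simp add: lessThan_Suc_atMost[symmetric] algebra_simps)
  also have "(2 * c - 1) * folded n c (bary n x) n = (2 - 1 / c) * min (bary n x 0) (bary n x 1)"
    using assms(1,2) by (simp add: folded_def field_simps)
  finally show ?thesis by simp
qed

lemma moenkemeyer_eq_step: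
  assumes n: "1 \<le> n" and x: "x \<in> Delta n"
  shows "moenkemeyer n x = step n 1 x"
proof -
  \<comment> \<open>The half with digit 0 contains the overlap, so the other branch is taken under
    strict inequality only.\<close>
  have a: "x \<notin> Delta_sub n False \<longleftrightarrow> bary n x 0 < bary n x 1" using x by (auto simp: Delta_sub_eq[OF n])
  have "\<forall>i\<ge>n. x i = 0" using x by (simp add: Delta_eq[OF n])
  then have "moenkemeyer n x = proj_point n (mat_V n *\<^sub>v Matrix.vec (n + 1) (folded n 1 (bary n x)))"
    unfolding moenkemeyer_def mat_M_def mat_A_def using branch_mult_homog[OF n _ _ a] by simp
  also have "\<dots> = step n 1 x"
    unfolding step_def by (subst proj_point_mat_V) (auto intro: pt_cong)
  finally show ?thesis .
qed

lemma tent_eq_step: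
  assumes n: "1 \<le> n" and x: "x \<in> Delta n"
  shows "tent n x = step n (1/2) x"
proof -
  have a: "x \<notin> Delta_sub n False \<longleftrightarrow> bary n x 0 < bary n x 1" using x by (auto simp: Delta_sub_eq[OF n])
  have x0: "\<forall>i\<ge>n. x i = 0" using x by (simp add: Delta_eq[OF n])
  let ?f = "folded n (1/2) (bary n x)"
  have "tent n x i = (if i < n then vec_index (mat_V n *\<^sub>v Matrix.vec (n + 1) ?f) i else 0)" for i
    unfolding tent_def mat_T_def mat_B_def using branch_mult_homog[OF n _ x0 a, of "1/2"] by simp
  also have "\<dots> i = (if i < n then \<Sum>j=1..n - i. ?f j else 0)" for i
    using mat_V_mult_vec[of i n ?f] by simp
  also have "\<dots> i = step n (1/2) x i" for i
    using sum_folded[OF n, of "1/2" x] x0 by (simp add: step_def pt_def)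
  finally show ?thesis by blast
qed

subsection \<open>Coding\<close>

lemma DeltaD:
  assumes "1 \<le> n" "x \<in> Delta n"
  shows "\<forall>i\<ge>n. x i = 0" "\<And>j. j \<le> n \<Longrightarrow> 0 \<le> bary n x j" "(\<Sum>j\<le>n. bary n x j) = 1"
  using assms sum_bary_all[of x n] by (auto simp: Delta_eq)

lemma pt_in_Delta:
  assumes "1 \<le> n" "\<And>j. j \<le> n \<Longrightarrow> 0 \<le> y j" "0 < (\<Sum>j\<le>n. y j)"
  shows "pt n y \<in> Delta n"
  using assms by (auto simp: Delta_eq pt_zero bary_pt)

lemma Delta_sub_subset: "1 \<le> n \<Longrightarrow> Delta_sub n a \<subseteq> Delta n"
  by (auto simp: Delta_sub_eq)

lemma act_nonneg:
  "0 < c \<Longrightarrow> (\<And>j. j \<le> n \<Longrightarrow> 0 \<le> y j) \<Longrightarrow> k \<le> n \<Longrightarrow> 0 \<le> act n c a y k"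
  by (cases "k \<le> 1") (auto simp: act_def)

lemma act_scale: "act n c a (\<lambda>j. r * y j) k = r * act n c a y k"
  by (simp add: act_def algebra_simps)

lemma act_cong: "1 \<le> n \<Longrightarrow> k \<le> n \<Longrightarrow> (\<And>j. j \<le> n \<Longrightarrow> y j = z j) \<Longrightarrow> act n c a y k = act n c a z k"
  by (cases "k \<le> 1") (auto simp: act_def)

text \<open>An entry of \<open>act\<close> is a sum of nonnegative terms and vanishes only if all of
  them do. This depends on the zeros of \<open>y\<close> and not on \<open>c\<close>, which is why
  both maps treat the faces alike.\<close>

lemma act_zero:
  assumes "1 \<le> n" "0 < c" "\<And>j. j \<le> n \<Longrightarrow> 0 \<le> y j" "k \<le> n" "act n c a y k = 0"
    and "\<And>j. j \<le> n \<Longrightarrow> y j = 0 \<Longrightarrow> z j = 0"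
  shows "act n c' a z k = 0"
proof (cases "k \<le> 1")
  case True
  define u where "u = (if a = (k = 1) then y 0 else 0)"
  have "0 \<le> c * y n" "0 \<le> u" using assms(2,3) by (simp_all add: u_def)
  moreover have "u + c * y n = 0"
    using assms(5) True by (auto simp: act_def le_Suc_eq u_def split: if_splits)
  ultimately have "c * y n = 0" "u = 0" by linarith+
  then have "z n = 0" "a = (k = 1) \<longrightarrow> z 0 = 0"
    using assms(2,6) by (auto simp: u_def)
  then show ?thesis using True by (auto simp: act_def)
next
  case False
  then show ?thesis using assms(4,5) assms(6)[of "k - 1"] by (simp add: act_def)
qed

section \<open>Inverse branches and cylinders of one folding map\<close>

locale fold_map =
  fixes n :: nat and c :: real
  assumes n: "1 \<le> n" and c: "c = 1 \<or> c = 1 / 2"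
begin

lemma c_pos: "0 < c" "c \<noteq> 0"
  using c by auto

abbreviation F :: "(nat \<Rightarrow> real) \<Rightarrow> nat \<Rightarrow> real" where "F \<equiv> step n c"
abbreviation cyl :: "(nat \<Rightarrow> bool) \<Rightarrow> nat \<Rightarrow> (nat \<Rightarrow> real) set" where "cyl \<equiv> cylinder n F"

text \<open>The smaller of the first two weights is at most 1/2, so folding removes at most half of
  the total mass.\<close>

lemma sum_folded_pos:
  assumes "x \<in> Delta n"
  shows "0 < (\<Sum>j\<le>n. folded n c (bary n x) j)"
proof -
  note x = DeltaD[OF n assms]
  have "bary n x 0 + bary n x 1 \<le> (\<Sum>j\<le>n. bary n x j)"
    using sum_mono2[of "{..n}" "{0, 1}" "bary n x"] x(2) n by auto
  then have "min (bary n x 0) (bary n x 1) \<le> 1 / 2" using x(3) by linarith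
  moreover have "2 - 1 / c = 0 \<or> 2 - 1 / c = 1"
  proof (cases "c = 1")
    case False
    then have "c = 1 / 2" using c by blast
    then show ?thesis unfolding \<open>c = 1 / 2\<close> by simp
  qed simp
  ultimately have "(2 - 1 / c) * min (bary n x 0) (bary n x 1) \<le> 1 / 2"
    by (metis mult_1 mult_zero_left zero_le_divide_1_iff zero_le_numeral)
  moreover have "x n = 0" using x(1) by simp
  ultimately show ?thesis using sum_folded[OF n c_pos(2), of x] by linarith
qed

lemma folded_nonneg:
  assumes "x \<in> Delta n" "j \<le> n"
  shows "0 \<le> folded n c (bary n x) j"
proof -
  note x = DeltaD[OF n assms(1)]
  have "0 \<le> min (bary n x 0) (bary n x 1)" "j < n \<Longrightarrow> 0 \<le> bary n x (Suc j)" using x(2) n by simp_all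
  then show ?thesis using c_pos assms(2) by (simp add: folded_def)
qed

lemma F_Delta: "x \<in> Delta n \<Longrightarrow> F x \<in> Delta n"
  unfolding step_def by (intro pt_in_Delta n folded_nonneg sum_folded_pos)

lemma bary_F:
  assumes "x \<in> Delta n" "j \<le> n"
  shows "bary n (F x) j = folded n c (bary n x) j / (\<Sum>j\<le>n. folded n c (bary n x) j)"
  unfolding step_def by (intro bary_pt n assms less_imp_neq[THEN not_sym] sum_folded_pos)

lemma Delta_sub_bary:
  assumes "x \<in> Delta_sub n a"
  shows "\<exists>r>0. \<forall>k\<le>n. bary n x k = r * act n c a (bary n (F x)) k"
proof (intro exI conjI allI impI)
  let ?S = "\<Sum>j\<le>n. folded n c (bary n x) j"
  have x: "x \<in> Delta n" and a: "if a then bary n x 0 \<le> bary n x 1 else bary n x 1 \<le> bary n x 0"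
    using assms by (auto simp: Delta_sub_eq[OF n])
  show S: "0 < ?S" by (rule sum_folded_pos[OF x])
  fix k assume k: "k \<le> n"
  have "?S * act n c a (bary n (F x)) k = act n c a (\<lambda>j. ?S * bary n (F x) j) k"
    by (rule act_scale[symmetric])
  also have "\<dots> = act n c a (folded n c (bary n x)) k"
    by (rule act_cong[OF n k]) (use bary_F[OF x] S in auto)
  also have "\<dots> = bary n x k" by (rule act_folded[OF n c_pos(2) a k])
  finally show "bary n x k = ?S * act n c a (bary n (F x)) k" by simp
qed

text \<open>The inverse branch of \<open>F\<close> with values in the half with digit
  \<open>a\<close>.\<close>

definition branch :: "bool \<Rightarrow> (nat \<Rightarrow> real) \<Rightarrow> nat \<Rightarrow> real" where
  "branch a y = pt n (act n c a (bary n y))"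

lemma sum_act_pos:
  assumes "y \<in> Delta n"
  shows "0 < (\<Sum>k\<le>n. act n c a (bary n y) k)"
proof -
  note y = DeltaD[OF n assms]
  have "(\<Sum>j<n. bary n y j) + bary n y n = 1" using y(3) by (simp add: lessThan_Suc_atMost[symmetric])
  moreover have "bary n y n \<le> 2 * c * bary n y n" 
  proof -
    have "1 \<le> 2 * c" using c by auto
    from mult_right_mono[OF this y(2)[of n]] show ?thesis by simp
  qed
  ultimately show ?thesis unfolding sum_act[OF n] by linarith
qed

lemma branch_Delta: "y \<in> Delta n \<Longrightarrow> branch a y \<in> Delta n"
  unfolding branch_def by (intro pt_in_Delta n sum_act_pos act_nonneg c_pos DeltaD(2))

lemma bary_branch:
  assumes "y \<in> Delta n" "k \<le> n"
  shows "bary n (branch a y) k = act n c a (bary n y) k / (\<Sum>k\<le>n. act n c a (bary n y) k)"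
  unfolding branch_def by (intro bary_pt n assms less_imp_neq[THEN not_sym] sum_act_pos)

lemma branch_Delta_sub:
  assumes "y \<in> Delta n"
  shows "branch a y \<in> Delta_sub n a"
proof -
  have "if a then act n c a (bary n y) 0 \<le> act n c a (bary n y) 1 else act n c a (bary n y) 1 \<le> act n c a (bary n y) 0"
    using DeltaD(2)[OF n assms] by (auto simp: act_def)
  then show ?thesis using branch_Delta[OF assms] sum_act_pos[OF assms, of a] bary_branch[OF assms, of _ a] n
    by (auto simp: Delta_sub_eq intro!: divide_right_mono)
qed

lemma F_branch:
  assumes "y \<in> Delta n"
  shows "F (branch a y) = y"
proof -
  let ?S = "\<Sum>k\<le>n. act n c a (bary n y) k"
  note y = DeltaD[OF n assms]
  have S: "0 < ?S" by (rule sum_act_pos[OF assms])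
  have "folded n c (bary n (branch a y)) j = 1 / ?S * bary n y j" if "j \<le> n" for j
  proof -
    have b: "bary n (branch a y) k = act n c a (bary n y) k / ?S" if "k \<le> n" for k
      using bary_branch[OF assms that] .
    have b01: "\<bar>act n c a (bary n y) 0 - act n c a (bary n y) 1\<bar> = bary n y 0"
      "min (act n c a (bary n y) 0) (act n c a (bary n y) 1) = c * bary n y n"
      using y(2)[of 0] by (auto simp: act_def)
    have "min (act n c a (bary n y) 0 / ?S) (act n c a (bary n y) 1 / ?S)
        = min (act n c a (bary n y) 0) (act n c a (bary n y) 1) / ?S"
      using S by (simp add: min_def divide_right_mono divide_le_cancel)
    moreover have "\<bar>act n c a (bary n y) 0 / ?S - act n c a (bary n y) 1 / ?S\<bar>
        = \<bar>act n c a (bary n y) 0 - act n c a (bary n y) 1\<bar> / ?S"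
      using S by (simp add: diff_divide_distrib[symmetric])
    moreover have "j < n \<Longrightarrow> j \<noteq> 0 \<Longrightarrow> act n c a (bary n y) (Suc j) = bary n y j"
      by (simp add: act_def)
    ultimately show ?thesis using that n c_pos b01 b[of 0] b[of 1] b[of "Suc j"]
      by (auto simp: folded_def)
  qed
  then have "F (branch a y) = pt n (\<lambda>j. 1 / ?S * bary n y j)"
    unfolding step_def by (rule pt_cong)
  also have "\<dots> = pt n (bary n y)" by (rule pt_scale) (use S in auto)
  also have "\<dots> = y" by (rule pt_bary[OF y(1)])
  finally show ?thesis .
qed

lemma F_pow_Delta: "x \<in> Delta n \<Longrightarrow> (F ^^ t) x \<in> Delta n"
  by (induction t) (auto intro: F_Delta)

lemma cyl_subset: "cyl a t \<subseteq> Delta n"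
  by (auto simp: cylinder_def)

lemma cyl_Suc: "x \<in> cyl a (Suc t) \<longleftrightarrow> x \<in> Delta_sub n (a 0) \<and> F x \<in> cyl (\<lambda>i. a (Suc i)) t"
proof -
  have "x \<in> Delta_sub n (a 0) \<Longrightarrow> x \<in> Delta n \<and> F x \<in> Delta n"
    using Delta_sub_subset[OF n] F_Delta by blast
  then show ?thesis by (auto simp: cylinder_def All_less_Suc2 funpow_swap1 simp del: funpow.simps)
      (auto simp: funpow_swap1 funpow_Suc_right simp del: funpow.simps(2))
qed

lemma cyl_antimono: "s \<le> t \<Longrightarrow> cyl a t \<subseteq> cyl a s"
  by (auto simp: cylinder_def)

lemma cyl_cong: "(\<And>i. i < t \<Longrightarrow> a i = b i) \<Longrightarrow> cyl a t = cyl b t"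
  by (auto simp: cylinder_def)

text \<open>Pulling a point back through the inverse branches realises any prescribed word.\<close>

lemma cyl_nonempty: "cyl a t \<noteq> {}"
proof (induction t arbitrary: a)
  case 0
  have "(\<Sum>j\<le>n. if j = 0 then 1 else 0 :: real) = 1" by simp
  then have "pt n (\<lambda>j. if j = 0 then 1 else 0) \<in> Delta n" by (intro pt_in_Delta n) auto
  then show ?case by (auto simp: cylinder_def)
next
  case (Suc t)
  then obtain y where y: "y \<in> cyl (\<lambda>i. a (Suc i)) t" by blast
  then have "y \<in> Delta n" using cyl_subset by blast
  then have "branch (a 0) y \<in> cyl a (Suc t)"
    unfolding cyl_Suc using y by (simp add: branch_Delta_sub F_branch)
  then show ?case by blast
qed

text \<open>Transposition: applying the matrix to the weights amounts to one queue step for the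
  functional.\<close>

lemma act_queue:
  "(\<Sum>j\<le>n. act n c (a t) z j * queue n c a p t j) = (\<Sum>j\<le>n. z j * queue n c a p (Suc t) j)"
proof -
  define q where "q = queue n c a p t"
  obtain m where m: "n = Suc m" using n by (cases n) auto
  have "(\<Sum>j\<le>n. act n c (a t) z j * q j)
    = act n c (a t) z 0 * q 0 + act n c (a t) z 1 * q 1 + (\<Sum>k<m. z (Suc k) * q (Suc (Suc k)))"
    unfolding m by (simp only: lessThan_Suc_atMost[symmetric] sum.lessThan_Suc_shift)
      (simp add: act_def)
  also have "\<dots> = z 0 * q (if a t then 1 else 0) + z n * (c * (q 0 + q 1)) + (\<Sum>k<m. z (Suc k) * q (Suc (Suc k)))"
    by (simp add: act_def algebra_simps)
  also have "\<dots> = (\<Sum>j\<le>n. z j * queue n c a p (Suc t) j)"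
  proof -
    have "(\<Sum>j\<le>n. z j * queue n c a p (Suc t) j)
      = z 0 * queue n c a p (Suc t) 0 + (\<Sum>k<m. z (Suc k) * queue n c a p (Suc t) (Suc k)) + z n * queue n c a p (Suc t) n"
      unfolding m by (simp only: lessThan_Suc_atMost[symmetric] sum.lessThan_Suc_shift[of _ m] sum.lessThan_Suc[of _ "Suc m"])
    also have "(\<Sum>k<m. z (Suc k) * queue n c a p (Suc t) (Suc k)) = (\<Sum>k<m. z (Suc k) * q (Suc (Suc k)))"
      by (rule sum.cong) (auto simp: q_def m)
    finally show ?thesis using n by (simp add: q_def)
  qed
  finally show ?thesis by (simp add: q_def)
qed

text \<open>The barycentric coordinates of the \<open>t\<close>-th iterate are, up to scaling, the
  coefficients of \<open>x\<close> in the columns of the matrix product. One factor \<open>r\<close>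
  serves all functionals, so it can be computed from a constant one.\<close>

lemma cyl_queue:
  "x \<in> cyl a t \<Longrightarrow> \<exists>r>0. \<forall>p. (\<Sum>j\<le>n. bary n x j * p j) = r * (\<Sum>j\<le>n. bary n ((F ^^ t) x) j * queue n c a p t j)"
proof (induction t)
  case 0
  show ?case by (rule exI[of _ 1]) simp
next
  case (Suc t)
  let ?y = "(F ^^ t) x"
  have "x \<in> cyl a t" using Suc.prems cyl_antimono[of t "Suc t" a] by auto
  then obtain r where r: "r > 0" "\<And>p. (\<Sum>j\<le>n. bary n x j * p j) = r * (\<Sum>j\<le>n. bary n ?y j * queue n c a p t j)"
    using Suc.IH by blast
  have "?y \<in> Delta_sub n (a t)" using Suc.prems by (auto simp: cylinder_def)
  then obtain s where s: "s > 0" "\<And>k. k \<le> n \<Longrightarrow> bary n ?y k = s * act n c (a t) (bary n (F ?y)) k"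
    using Delta_sub_bary by blast
  have "(\<Sum>j\<le>n. bary n x j * p j) = (r * s) * (\<Sum>j\<le>n. bary n ((F ^^ Suc t) x) j * queue n c a p (Suc t) j)" for p
  proof -
    have "(\<Sum>j\<le>n. bary n x j * p j) = r * (\<Sum>j\<le>n. s * (act n c (a t) (bary n (F ?y)) j * queue n c a p t j))"
      unfolding r(2) using s(2) by (intro arg_cong[where f = "(*) r"] sum.cong) auto
    also have "\<dots> = r * s * (\<Sum>j\<le>n. act n c (a t) (bary n (F ?y)) j * queue n c a p t j)"
      by (simp add: sum_distrib_left mult.assoc)
    finally show ?thesis unfolding act_queue by simp
  qed
  then show ?case using r(1) s(1) by (intro exI[of _ "r * s"]) simp
qed

lemma coordinate_bary:
  assumes "x \<in> Delta n"
  shows "x i = (\<Sum>j\<le>n. bary n x j * (if 1 \<le> j \<and> i + j \<le> n then 1 else 0))"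
proof -
  have "(\<Sum>j\<le>n. bary n x j * (if 1 \<le> j \<and> i + j \<le> n then 1 else 0)) = (\<Sum>j\<in>{1..n - i}. bary n x j)"
    by (rule sum.mono_neutral_cong_right) auto
  also have "\<dots> = x (n - (n - i))" using DeltaD(1)[OF n assms] by (intro sum_bary) auto
  also have "\<dots> = x i" using DeltaD(1)[OF n assms] by (cases "i \<le> n") auto
  finally show ?thesis by simp
qed

lemma cyl_shrink:
  assumes "0 < e"
  shows "\<exists>t. \<forall>x\<in>cyl a t. \<forall>y\<in>cyl a t. \<bar>x i - y i\<bar> \<le> e"
proof -
  define p where "p j = (if 1 \<le> j \<and> i + j \<le> n then 1 else 0 :: real)" for j
  interpret vq: vertex_queue n c a p by unfold_locales (rule n, rule c)
  obtain t A B where t: "B - A \<le> e" "vq.ratios_in t A B" using vq.shrink[OF assms] by blast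
  have "A \<le> x i \<and> x i \<le> B" if x: "x \<in> cyl a t" for x
  proof -
    obtain r where r: "r > 0" "\<And>p. (\<Sum>j\<le>n. bary n x j * p j) = r * (\<Sum>j\<le>n. bary n ((F ^^ t) x) j * queue n c a p t j)"
      using cyl_queue[OF x] by blast
    let ?z = "bary n ((F ^^ t) x)"
    have xD: "x \<in> Delta n" using x cyl_subset by blast
    have z: "0 \<le> ?z j" if "j \<le> n" for j using DeltaD(2)[OF n F_pow_Delta[OF xD] that] .
    \<comment> \<open>The constant functional determines \<open>r\<close> and makes
      \<open>x i\<close> a weighted mean of the ratios \<open>vq.P t j / vq.d t j\<close>.\<close>
    have 1: "1 = r * (\<Sum>j\<le>n. ?z j * vq.d t j)"
      using r(2)[of "\<lambda>_. 1"] DeltaD(3)[OF n xD] by (simp add: vq.d_def)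
    have 2: "x i = r * (\<Sum>j\<le>n. ?z j * vq.P t j)"
      unfolding vq.P_def r(2)[symmetric] p_def by (rule coordinate_bary[OF xD])
    have "A * (\<Sum>j\<le>n. ?z j * vq.d t j) \<le> (\<Sum>j\<le>n. ?z j * vq.P t j)"
      unfolding sum_distrib_left
    proof (rule sum_mono)
      fix j assume "j \<in> {..n}"
      then have "?z j * (A * vq.d t j) \<le> ?z j * vq.P t j"
        using t(2) z by (intro mult_left_mono) (auto simp: vq.ratios_in_def)
      then show "A * (?z j * vq.d t j) \<le> ?z j * vq.P t j" by (simp only: mult.left_commute)
    qed
    moreover have "(\<Sum>j\<le>n. ?z j * vq.P t j) \<le> B * (\<Sum>j\<le>n. ?z j * vq.d t j)"
      unfolding sum_distrib_left
    proof (rule sum_mono)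
      fix j assume "j \<in> {..n}"
      then have "?z j * vq.P t j \<le> ?z j * (B * vq.d t j)"
        using t(2) z by (intro mult_left_mono) (auto simp: vq.ratios_in_def)
      then show "?z j * vq.P t j \<le> B * (?z j * vq.d t j)" by (simp only: mult.left_commute)
    qed
    ultimately have "r * (A * (\<Sum>j\<le>n. ?z j * vq.d t j)) \<le> x i" "x i \<le> r * (B * (\<Sum>j\<le>n. ?z j * vq.d t j))"
      unfolding 2 using r(1) by (simp_all add: mult_left_mono)
    moreover have "r * (C * (\<Sum>j\<le>n. ?z j * vq.d t j)) = C" for C
      using 1 by (metis mult.left_commute mult.right_neutral)
    ultimately show ?thesis by simp
  qed
  then show ?thesis using t(1) by (intro exI[of _ t] ballI) (smt (verit))
qed

end

section \<open>Compactness and continuity of the coding\<close>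

lemma continuous_on_bary [continuous_intros]: "continuous_on S (\<lambda>x. bary n x j)"
proof -
  have "continuous_on S (\<lambda>x::nat \<Rightarrow> real. x i)" for i
    by (rule continuous_on_subset[OF continuous_on_product_coordinates]) simp
  then show ?thesis by (cases "j = 0") (auto simp: bary_def intro!: continuous_intros)
qed

lemma continuous_on_pt:
  assumes "\<And>j. continuous_on S (\<lambda>x. f x j)" "\<And>x. x \<in> S \<Longrightarrow> (\<Sum>j\<le>n. f x j) \<noteq> 0"
  shows "continuous_on S (\<lambda>x. pt n (f x))"
proof (rule continuous_on_coordinatewise_then_product)
  fix i show "continuous_on S (\<lambda>x. pt n (f x) i)"
    using assms by (cases "i < n") (auto simp: pt_def intro!: continuous_intros)
qed

lemma compact_standard_simplex: "compact (standard_simplex n)"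
  using compactin_standard_simplex[of n] by (simp add: euclidean_product_topology)

lemma compact_Delta:
  assumes n: "1 \<le> n"
  shows "compact (Delta n)"
proof -
  have sum1: "(\<Sum>j\<le>n. y j) = 1" "\<And>j. 0 \<le> y j" if "y \<in> standard_simplex n" for y
    using that by (auto simp: standard_simplex_def)
  have "continuous_on (standard_simplex n) (\<lambda>y. pt n y)"
    by (rule continuous_on_pt) (auto simp: sum1 intro: continuous_on_subset[OF continuous_on_product_coordinates])
  then have "compact (pt n ` standard_simplex n)"
    using compact_standard_simplex by (rule compact_continuous_image)
  moreover have "pt n ` standard_simplex n = Delta n"
  proof
    show "pt n ` standard_simplex n \<subseteq> Delta n"
      using sum1 by (auto intro!: pt_in_Delta n)
    show "Delta n \<subseteq> pt n ` standard_simplex n"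
    proof
      fix x assume "x \<in> Delta n"
      note x = DeltaD[OF n this]
      have std: "(\<lambda>j. if j \<le> n then bary n x j else 0) \<in> standard_simplex n"
        using x by (intro standard_simplexI) auto
      have "x = pt n (\<lambda>j. if j \<le> n then bary n x j else 0)"
        using pt_bary[OF x(1)] pt_cong[of n "\<lambda>j. if j \<le> n then bary n x j else 0" "bary n x"] by simp
      then show "x \<in> pt n ` standard_simplex n" by (rule image_eqI[OF _ std])
    qed
  qed
  ultimately show ?thesis by simp
qed

lemma closed_Delta: "1 \<le> n \<Longrightarrow> closed (Delta n)"
  using compact_Delta compact_imp_closed by blast

lemma closed_Delta_sub:
  assumes "1 \<le> n"
  shows "closed (Delta_sub n a)"
proof -
  have "Delta_sub n a = Delta n \<inter> (if a then {x. bary n x 0 \<le> bary n x 1} else {x. bary n x 1 \<le> bary n x 0})"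
    using Delta_sub_eq[OF assms] by auto
  then show ?thesis using closed_Delta[OF assms]
    by (auto intro!: closed_Int closed_Collect_le continuous_intros)
qed

context fold_map
begin

lemma continuous_on_F: "continuous_on (Delta n) F"
  unfolding step_def
proof (rule continuous_on_pt)
  fix x assume "x \<in> Delta n"
  then show "(\<Sum>j\<le>n. folded n c (bary n x) j) \<noteq> 0" using sum_folded_pos by fastforce
next
  fix j
  show "continuous_on (Delta n) (\<lambda>x. folded n c (bary n x) j)"
    using c_pos by (cases "j = 0"; cases "j = n") (auto simp: folded_def intro!: continuous_intros)
qed

lemma closed_cyl: "closed (cyl a t)"
proof (induction t arbitrary: a)
  case 0
  show ?case using closed_Delta[OF n] by (simp add: cylinder_def)
next
  case (Suc t)
  have "cyl a (Suc t) = Delta_sub n (a 0) \<inter> F -` cyl (\<lambda>i. a (Suc i)) t"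
    using cyl_Suc by blast
  then show ?case
    using continuous_on_subset[OF continuous_on_F Delta_sub_subset[OF n]] closed_Delta_sub[OF n] Suc
    by (simp add: continuous_closed_preimage)
qed

abbreviation coded :: "(nat \<Rightarrow> bool) \<Rightarrow> nat \<Rightarrow> real" where "coded \<equiv> coded_point n F"

lemma cyl_point_unique:
  assumes "\<And>t. x \<in> cyl a t" "\<And>t. y \<in> cyl a t"
  shows "x = y"
proof (rule ext)
  fix i
  have "\<bar>x i - y i\<bar> \<le> 0 + e" if "0 < e" for e
    using cyl_shrink[OF that, of a i] assms by auto
  then have "\<bar>x i - y i\<bar> \<le> 0" by (rule field_le_epsilon)
  then show "x i = y i" by simp
qed

lemma coded_eq: "(\<And>t. x \<in> cyl a t) \<Longrightarrow> coded a = x"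
  unfolding coded_point_def by (rule the_equality) (auto intro: cyl_point_unique)

text \<open>Compactness gives the nested cylinders a common point, and their shrinking makes it
  unique, so the description in \<open>coded_point\<close> denotes.\<close>

lemma coded_in_cyl: "coded a \<in> cyl a t"
proof -
  have "compact_space (top_of_set (Delta n))"
    using compact_Delta[OF n] by (simp add: compact_space_subtopology)
  then have "(\<Inter>t. cyl a t) \<noteq> {}"
    by (rule compact_space_imp_nest)
      (auto intro: closed_subset[OF cyl_subset closed_cyl] simp: cyl_nonempty decseq_def cyl_antimono[THEN subsetD])
  then obtain x where "\<And>t. x \<in> cyl a t" by blast
  then show ?thesis using coded_eq by metis
qed

lemma coded_Delta: "coded a \<in> Delta n"
  using coded_in_cyl[of a 0] cyl_subset by blast

lemma coded_surj: "x \<in> Delta n \<Longrightarrow> \<exists>a. coded a = x"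
proof -
  assume x: "x \<in> Delta n"
  \<comment> \<open>The itinerary of \<open>x\<close>, with ties decided in favour of digit
    0.\<close>
  define a where "a i \<longleftrightarrow> bary n ((F ^^ i) x) 0 < bary n ((F ^^ i) x) 1" for i
  have "x \<in> cyl a t" for t
    using x F_pow_Delta[OF x] by (auto simp: cylinder_def Delta_sub_eq[OF n] a_def)
  then show ?thesis using coded_eq by blast
qed

text \<open>A cylinder of level \<open>t\<close> depends only on the first \<open>t\<close> digits,
  so codes that agree on these have nearby points.\<close>

lemma continuous_on_coded: "continuous_on UNIV coded"
proof (rule continuous_on_coordinatewise_then_product)
  fix i
  show "continuous_on UNIV (\<lambda>a. coded a i)"
    unfolding continuous_on_def
  proof (intro ballI tendstoI)
    fix a :: "nat \<Rightarrow> bool" and e :: real assume "0 < e"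
    then obtain t where t: "\<And>x y. x \<in> cyl a t \<Longrightarrow> y \<in> cyl a t \<Longrightarrow> \<bar>x i - y i\<bar> \<le> e / 2"
      using cyl_shrink[of "e / 2" a i] by auto
    have "open ((\<lambda>b. b k) -` {a k})" for k
      by (rule open_vimage) (auto intro: open_discrete)
    then have "open (\<Inter>k<t. (\<lambda>b. b k) -` {a k})"
      by (intro open_INT) auto
    moreover have "dist (coded b i) (coded a i) < e" if "b \<in> (\<Inter>k<t. (\<lambda>b. b k) -` {a k})" for b
    proof -
      have "cyl b t = cyl a t" using that by (intro cyl_cong) auto
      then have "\<bar>coded b i - coded a i\<bar> \<le> e / 2" using t coded_in_cyl by metis
      then show ?thesis using \<open>0 < e\<close> by (simp add: dist_real_def)
    qed
    ultimately show "\<forall>\<^sub>F b in at a. dist (coded b i) (coded a i) < e"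
      unfolding eventually_at_topological by (intro exI[of _ "\<Inter>k<t. (\<lambda>b. b k) -` {a k}"]) auto
  qed
qed

end

lemma compact_bool_sequences: "compact (UNIV :: (nat \<Rightarrow> bool) set)"
proof -
  have "compact_space (product_topology (\<lambda>i::nat. euclidean :: bool topology) UNIV)"
    by (simp add: compact_space_product_topology) (simp add: compact_space_def compactin_euclidean_iff finite_imp_compact)
  then show ?thesis by (simp add: euclidean_product_topology compact_space_def)
qed

section \<open>Comparison of the two codings\<close>

locale fold_map_pair = A: fold_map n c + B: fold_map n c' for n c c'
begin

text \<open>The finite-level approximations of the conjugacy; they need not be continuous for our purposes,
  since they only serve to compare the combinatorics of the two families of cylinders.\<close>
primrec approx_conj :: "nat \<Rightarrow> (nat \<Rightarrow> real) \<Rightarrow> nat \<Rightarrow> real" where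
  "approx_conj 0 = (\<lambda>x. x)"
| "approx_conj (Suc t) = (\<lambda>x. B.branch (bary n x 0 < bary n x 1) (approx_conj t (step n c x)))"

lemma approx_conj_Delta: "x \<in> Delta n \<Longrightarrow> approx_conj t x \<in> Delta n"
  by (induction t arbitrary: x) (auto intro: B.branch_Delta A.F_Delta)

text \<open>The inverse branches of both maps create zero coordinates in the same way, so every
  pull-back respects the faces.\<close>

lemma approx_conj_zero: "x \<in> Delta n \<Longrightarrow> j \<le> n \<Longrightarrow> bary n x j = 0 \<Longrightarrow> bary n (approx_conj t x) j = 0"
proof (induction t arbitrary: x j)
  case (Suc t)
  let ?a = "bary n x 0 < bary n x 1" and ?y = "step n c x"
  have y: "?y \<in> Delta n" using A.F_Delta Suc.prems(1) .
  have "x \<in> Delta_sub n ?a" using Suc.prems(1) by (auto simp: Delta_sub_eq[OF A.n])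
  then obtain r where "r > 0" "bary n x j = r * act n c ?a (bary n ?y) j"
    using A.Delta_sub_bary Suc.prems(2) by blast
  then have "act n c ?a (bary n ?y) j = 0" using Suc.prems(3) by simp
  then have "act n c' ?a (bary n (approx_conj t ?y)) j = 0"
    using act_zero[of n c "bary n ?y" j ?a "bary n (approx_conj t ?y)" c', OF A.n A.c_pos(1)]
      DeltaD(2)[OF A.n y] Suc.prems(2) Suc.IH[OF y] by blast
  then show ?case using B.bary_branch[OF approx_conj_Delta[OF y] Suc.prems(2)] by simp
qed simp

lemma approx_conj_cyl: "x \<in> A.cyl a t \<Longrightarrow> approx_conj t x \<in> B.cyl a t"
proof (induction t arbitrary: x a)
  case 0
  then show ?case by (simp add: cylinder_def)
next
  case (Suc t)
  let ?a = "bary n x 0 < bary n x 1" and ?y = "step n c x"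
  have x: "x \<in> Delta_sub n (a 0)" and y: "?y \<in> A.cyl (\<lambda>i. a (Suc i)) t"
    using Suc.prems A.cyl_Suc by auto
  have xD: "x \<in> Delta n" and yD: "?y \<in> Delta n" using x y Delta_sub_subset[OF A.n] A.cyl_subset by blast+
  let ?z = "approx_conj t ?y"
  have zD: "?z \<in> Delta n" by (rule approx_conj_Delta[OF yD])
  \<comment> \<open>On the overlap the digit used by \<open>approx_conj\<close> may differ from
    \<open>a 0\<close>. There coordinate 0 of the image vanishes, and both inverse branches agree on
    points with this property.\<close>
  have "B.branch ?a ?z = B.branch (a 0) ?z"
  proof (cases "?a = a 0")
    case False
    then have "bary n x 0 = bary n x 1" using x by (auto simp: Delta_sub_eq[OF A.n] split: if_splits)
    then have "folded n c (bary n x) 0 = 0" by (simp add: folded_def)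
    then have "bary n ?y 0 = 0" using A.bary_F[OF xD, of 0] by simp
    then have "bary n ?z 0 = 0" using approx_conj_zero[OF yD] by simp
    then have "act n c' ?a (bary n ?z) = act n c' (a 0) (bary n ?z)" by (auto simp: act_def fun_eq_iff)
    then show ?thesis by (simp add: B.branch_def)
  qed simp
  then show ?case using Suc.IH[OF y] B.branch_Delta_sub[OF zD] B.F_branch[OF zD] by (simp add: B.cyl_Suc)
qed

lemma approx_conj_close:
  assumes "0 < e"
  shows "\<exists>s. \<forall>t\<ge>s. \<bar>B.coded a i - approx_conj t (A.coded a) i\<bar> \<le> e"
proof -
  obtain s where s: "\<And>x y. x \<in> B.cyl a s \<Longrightarrow> y \<in> B.cyl a s \<Longrightarrow> \<bar>x i - y i\<bar> \<le> e"
    using B.cyl_shrink[OF assms, of a i] by auto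
  have "\<bar>B.coded a i - approx_conj t (A.coded a) i\<bar> \<le> e" if "t \<ge> s" for t
    using s[OF B.coded_in_cyl] approx_conj_cyl[OF A.coded_in_cyl[of a t]] B.cyl_antimono[OF that, of a] by blast
  then show ?thesis by blast
qed

lemma approx_conj_tendsto: "(\<lambda>t. approx_conj t (A.coded a) i) \<longlonglongrightarrow> B.coded a i"
proof (rule LIMSEQ_I)
  fix e :: real assume "0 < e"
  then obtain s where s: "\<And>t. t \<ge> s \<Longrightarrow> \<bar>B.coded a i - approx_conj t (A.coded a) i\<bar> \<le> e / 2"
    using approx_conj_close[of "e / 2" a i] by auto
  show "\<exists>s. \<forall>t\<ge>s. norm (approx_conj t (A.coded a) i - B.coded a i) < e"
  proof (intro exI allI impI)
    fix t assume "t \<ge> s"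
    from s[OF this] show "norm (approx_conj t (A.coded a) i - B.coded a i) < e" using \<open>0 < e\<close>
      unfolding real_norm_def by arith
  qed
qed

text \<open>The approximations depend only on the point \<open>A.coded a\<close>, hence so does
  their limit \<open>B.coded a\<close>.\<close>

lemma coded_eq_transfer: "A.coded a = A.coded b \<Longrightarrow> B.coded a = B.coded b"
  using approx_conj_tendsto LIMSEQ_unique by (metis ext)

lemma coded_zero_transfer:
  assumes "j \<le> n" "bary n (A.coded a) j = 0"
  shows "bary n (B.coded a) j = 0"
proof -
  have "(\<lambda>t. bary n (approx_conj t (A.coded a)) j) \<longlonglongrightarrow> bary n (B.coded a) j"
    unfolding bary_def using approx_conj_tendsto by (cases "j = 0") (auto intro!: tendsto_intros)
  moreover have "bary n (approx_conj t (A.coded a)) j = 0" for t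
    by (rule approx_conj_zero[OF A.coded_Delta assms])
  ultimately show ?thesis by (simp add: LIMSEQ_const_iff)
qed

end

subsection \<open>Orientation\<close>

definition mix :: "real \<Rightarrow> (nat \<Rightarrow> real) \<Rightarrow> (nat \<Rightarrow> real) \<Rightarrow> nat \<Rightarrow> real" where
  "mix s x y = (\<lambda>i. (1 - s) * x i + s * y i)"

lemma bary_mix: "bary n (mix s x y) j = (1 - s) * bary n x j + s * bary n y j"
  by (simp add: bary_def mix_def algebra_simps)

lemma mix_Delta:
  "1 \<le> n \<Longrightarrow> x \<in> Delta n \<Longrightarrow> y \<in> Delta n \<Longrightarrow> s \<in> {0..1} \<Longrightarrow> mix s x y \<in> Delta n"
  by (simp add: Delta_eq bary_mix) (simp add: mix_def)

lemma Euclidean_space_eq: "Euclidean_space n = top_of_set {x. \<forall>i\<ge>n. x i = 0}"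
  by (simp add: Euclidean_space_def euclidean_product_topology)

lemma Euclidean_sub_Delta:
  assumes "1 \<le> n"
  shows "Euclidean_sub n (Delta n) = top_of_set (Delta n)"
proof -
  have "{x. \<forall>i\<ge>n. x i = 0} \<inter> Delta n = Delta n" using assms by (auto simp: Delta_eq)
  then show ?thesis by (simp add: Euclidean_sub_def Euclidean_space_eq subtopology_subtopology)
qed

lemma interior_Delta:
  assumes n: "1 \<le> n"
  shows "Euclidean_space n interior_of Delta n = {x. (\<forall>i\<ge>n. x i = 0) \<and> (\<forall>j\<le>n. 0 < bary n x j)}"
    (is "?I = ?P")
proof
  have "?P = {x. \<forall>i\<ge>n. x i = 0} \<inter> (\<Inter>j\<in>{..n}. {x. 0 < bary n x j})" by auto
  moreover have "open (\<Inter>j\<in>{..n}. {x. 0 < bary n x j})"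
    by (intro open_INT) (auto intro!: open_Collect_less continuous_intros)
  ultimately have "openin (Euclidean_space n) ?P"
    unfolding Euclidean_space_eq by (simp add: openin_open_Int)
  moreover have "?P \<subseteq> Delta n" by (auto simp: Delta_eq[OF n] less_imp_le)
  ultimately show "?P \<subseteq> ?I" by (rule interior_of_maximal[rotated])
next
  show "?I \<subseteq> ?P"
  proof
    fix p assume "p \<in> ?I"
    then obtain U where "openin (Euclidean_space n) U" "p \<in> U" "U \<subseteq> Delta n"
      by (auto simp: interior_of_def)
    then obtain V where V: "open V" "p \<in> V" "V \<inter> {x. \<forall>i\<ge>n. x i = 0} \<subseteq> Delta n"
      unfolding Euclidean_space_eq openin_open by blast
    have pD: "p \<in> Delta n" using \<open>p \<in> U\<close> \<open>U \<subseteq> Delta n\<close> by blast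
    note p = DeltaD[OF n pD]
    define z where "z = pt n (\<lambda>_. 1)"
    have z: "0 < bary n z j" if "j \<le> n" for j
      using bary_pt[OF n, of "\<lambda>_. 1" j] that by (simp add: z_def)
    \<comment> \<open>Moving \<open>p\<close> away from the barycentre \<open>z\<close> would make a
      vanishing coordinate negative.\<close>
    define f where "f s = mix (- s) p z" for s
    have "continuous_on UNIV f"
      unfolding f_def mix_def by (intro continuous_intros)
    then have "open (f -` V)" using V(1) by (rule open_vimage[rotated])
    moreover have "f 0 = p" by (simp add: f_def mix_def)
    then have "0 \<in> f -` V" using V(2) by simp
    ultimately obtain e where e: "0 < e" "ball 0 e \<subseteq> f -` V" by (meson open_contains_ball)
    have fE: "\<forall>i\<ge>n. f s i = 0" for s using p(1) by (simp add: f_def mix_def z_def pt_zero)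
    have "f (e / 2) \<in> V" using e by (auto simp: subset_iff)
    then have fD: "f (e / 2) \<in> Delta n" using V(3) fE by blast
    have "0 < bary n p j" if j: "j \<le> n" for j
    proof (rule ccontr)
      assume "\<not> ?thesis"
      then have "bary n p j = 0" using p(2)[OF j] by simp
      then have "bary n (f (e / 2)) j = - (e / 2) * bary n z j" by (simp add: f_def bary_mix)
      moreover have "0 < e / 2 * bary n z j" using e(1) z[OF j] by simp
      ultimately show False using DeltaD(2)[OF n fD j] by linarith
    qed
    then show "p \<in> ?P" using p(1) by simp
  qed
qed

definition boundary :: "nat \<Rightarrow> (nat \<Rightarrow> real) set" where
  "boundary n = {x \<in> Delta n. \<exists>j\<le>n. bary n x j = 0}"

section \<open>Straight-line homotopies and radial projection\<close>

lemma homotopic_linear: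
  assumes n: "1 \<le> n"
    and f: "continuous_on (Delta n) f" "f \<in> Delta n \<rightarrow> Delta n"
    and g: "continuous_on (Delta n) g" "g \<in> Delta n \<rightarrow> Delta n"
    and ST: "\<And>s x. s \<in> {0..1} \<Longrightarrow> x \<in> S \<Longrightarrow> mix s (f x) (g x) \<in> T"
  shows "homotopic_with (\<lambda>h. h \<in> S \<rightarrow> T) (top_of_set (Delta n)) (top_of_set (Delta n)) f g"
  unfolding homotopic_with_def
proof (intro exI conjI)
  let ?h = "\<lambda>(s, x). mix s (f x) (g x)"
  have "continuous_on ({0..1} \<times> Delta n) (\<lambda>y. mix (fst y) (f (snd y)) (g (snd y)))"
  proof (rule continuous_on_coordinatewise_then_product)
    fix i
    have "continuous_on ({0..1} \<times> Delta n) (\<lambda>y. f (snd y) i)" "continuous_on ({0..1} \<times> Delta n) (\<lambda>y. g (snd y) i)"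
      by (rule continuous_on_compose2[OF continuous_on_product_then_coordinatewise[OF f(1)]
            continuous_on_snd[OF continuous_on_id]], force)
        (rule continuous_on_compose2[OF continuous_on_product_then_coordinatewise[OF g(1)]
            continuous_on_snd[OF continuous_on_id]], force)
    then show "continuous_on ({0..1} \<times> Delta n) (\<lambda>y. mix (fst y) (f (snd y)) (g (snd y)) i)"
      unfolding mix_def by (intro continuous_intros)
  qed
  then have "continuous_on ({0..1} \<times> Delta n) ?h" by (simp add: case_prod_unfold)
  moreover have "?h \<in> {0..1} \<times> Delta n \<rightarrow> Delta n"
    using f(2) g(2) by (auto intro!: mix_Delta[OF n])
  ultimately show "continuous_map (prod_topology (top_of_set {0..1}) (top_of_set (Delta n))) (top_of_set (Delta n)) ?h"
    by simp
qed (use ST in \<open>auto simp: mix_def\<close>)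

lemma continuous_on_Max_atMost:
  fixes f :: "nat \<Rightarrow> 'a::topological_space \<Rightarrow> real"
  assumes "\<And>j. continuous_on S (f j)"
  shows "continuous_on S (\<lambda>x. Max ((\<lambda>j. f j x) ` {..k}))"
proof (induction k)
  case (Suc k)
  have "Max ((\<lambda>j. f j x) ` {..Suc k}) = max (f (Suc k) x) (Max ((\<lambda>j. f j x) ` {..k}))" for x
    by (simp add: atMost_Suc)
  then show ?case using Suc assms by (simp add: continuous_on_max)
qed (use assms in simp)

text \<open>The radial projection from an interior point of the convex body, measured by the gauge of the
  simplex and cut off near that point.\<close>
lemma radial_projection:
  assumes n: "1 \<le> n" and B: "convex_ball n B" "B \<subseteq> Euclidean_space n interior_of Delta n"
  shows "\<exists>r. continuous_on (Delta n) r \<and> r \<in> Delta n \<rightarrow> Delta n \<and> r \<in> (Delta n - B) \<rightarrow> boundary n \<and>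
    (\<forall>s\<in>{0..1}. \<forall>x\<in>Delta n - B. mix s x (r x) \<in> Delta n - B)"
proof -
  obtain q where "q \<in> Euclidean_space n interior_of B" using B(1) by (auto simp: convex_ball_def)
  then obtain U where "openin (Euclidean_space n) U" "q \<in> U" "U \<subseteq> B" by (auto simp: interior_of_def)
  then obtain V where V: "open V" "q \<in> V" "V \<inter> {x. \<forall>i\<ge>n. x i = 0} \<subseteq> B"
    unfolding Euclidean_space_eq openin_open by blast
  have qB: "q \<in> B" using \<open>q \<in> U\<close> \<open>U \<subseteq> B\<close> by blast
  then have q: "\<forall>i\<ge>n. q i = 0" "\<And>j. j \<le> n \<Longrightarrow> 0 < bary n q j"
    using B(2) interior_Delta[OF n] by auto
  have qD: "q \<in> Delta n" using q by (simp add: Delta_eq[OF n] less_imp_le)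
  have conv: "mix u x y \<in> B" if "x \<in> B" "y \<in> B" "u \<in> {0..1}" for x y u
    using B(1) that unfolding convex_ball_def mix_def by blast
  \<comment> \<open>The gauge of the simplex centred at \<open>q\<close>: it is 0 at
    \<open>q\<close>, positive elsewhere on the simplex, and 1 on the boundary.\<close>
  define g where "g x = Max ((\<lambda>j. 1 - bary n x j / bary n q j) ` {..n})" for x
  have g_ge: "1 - bary n x j / bary n q j \<le> g x" if "j \<le> n" for x j
    unfolding g_def using that by (intro Max_ge) auto
  have g_eq: "\<exists>j\<le>n. g x = 1 - bary n x j / bary n q j" for x
  proof -
    have "g x \<in> (\<lambda>j. 1 - bary n x j / bary n q j) ` {..n}" unfolding g_def by (rule Max_in) auto
    then show ?thesis by auto
  qed
  have g_cont: "continuous_on (Delta n) g"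
  proof -
    have "continuous_on (Delta n) (\<lambda>x. 1 - bary n x j * inverse (bary n q j))" for j
      by (intro continuous_intros)
    then show ?thesis unfolding g_def divide_inverse by (rule continuous_on_Max_atMost)
  qed
  have g_pos: "0 < g x" if x: "x \<in> Delta n" "x \<noteq> q" for x
  proof (rule ccontr)
    assume "\<not> 0 < g x"
    then have nonpos: "1 - bary n x j / bary n q j \<le> 0" if "j \<le> n" for j
      using g_ge[OF that, of x] by linarith
    have le: "bary n q j \<le> bary n x j" if "j \<le> n" for j
      using nonpos[OF that] q(2)[OF that] by (simp add: field_simps)
    have "bary n x j = bary n q j" if j: "j \<le> n" for j
    proof (rule ccontr)
      assume "bary n x j \<noteq> bary n q j"
      then have "(\<Sum>j\<le>n. bary n q j) < (\<Sum>j\<le>n. bary n x j)"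
        using le j by (intro sum_strict_mono_ex1) (auto intro!: bexI[of _ j] simp: less_le)
      then show False using DeltaD(3)[OF n x(1)] DeltaD(3)[OF n qD] by simp
    qed
    then show False using bary_inject DeltaD(1)[OF n x(1)] q(1) x(2) by metis
  qed
  have g_le: "g x \<le> 1" if "x \<in> Delta n" for x
    using g_eq[of x] DeltaD(2)[OF n that] q(2) by (auto intro!: divide_nonneg_pos)
  \<comment> \<open>The gauge has a positive minimum on the compact complement of a neighbourhood of
    \<open>q\<close>; if this complement is empty, any positive number will do.\<close>
  obtain e where e: "0 < e" "\<And>x. x \<in> Delta n - V \<Longrightarrow> e \<le> g x"
  proof (cases "Delta n - V = {}")
    case True then show ?thesis using that[of 1] by auto
  next
    case False
    have "compact (Delta n - V)" using compact_Delta[OF n] V(1) by (rule compact_diff)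
    then obtain x where "x \<in> Delta n - V" "\<And>y. y \<in> Delta n - V \<Longrightarrow> g x \<le> g y"
      using continuous_attains_inf[OF _ False continuous_on_subset[OF g_cont]] by blast
    then show ?thesis using that[of "g x"] g_pos[of x] V(2) by blast
  qed
  have eB: "e \<le> g x" if "x \<in> Delta n - B" for x
    using that V(3) DeltaD(1)[OF n] by (intro e(2)) blast
  \<comment> \<open>The cut-off takes effect only inside \<open>B\<close> and keeps the division
    continuous at \<open>q\<close>.\<close>
  define m where "m x = max (g x) e" for x
  have m_pos: "0 < m x" for x using e(1) by (simp add: m_def)
  define r where "r x = mix (1 / m x) q x" for x
  have bary_r: "bary n (r x) j = bary n q j + (bary n x j - bary n q j) / m x" for x j
    using m_pos[of x] by (simp add: r_def bary_mix field_simps)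
  have r_cont: "continuous_on (Delta n) r"
  proof (rule continuous_on_coordinatewise_then_product)
    fix i
    have x_cont: "continuous_on (Delta n) (\<lambda>x::nat \<Rightarrow> real. x i)"
      by (rule continuous_on_subset[OF continuous_on_product_coordinates]) simp
    have m_cont: "continuous_on (Delta n) (\<lambda>x. 1 / m x)"
      unfolding m_def using e(1) g_cont by (intro continuous_intros) (auto simp: max_def)
    show "continuous_on (Delta n) (\<lambda>x. r x i)"
      unfolding r_def mix_def
      by (intro continuous_on_add continuous_on_mult continuous_on_diff continuous_on_const x_cont m_cont)
  qed
  have r_Delta: "r x \<in> Delta n" if x: "x \<in> Delta n" for x
  proof -
    have "0 \<le> bary n (r x) j" if j: "j \<le> n" for j
    proof -
      have "1 - bary n x j / bary n q j \<le> m x" using g_ge[OF j, of x] by (simp add: m_def)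
      then have "bary n q j - bary n x j \<le> m x * bary n q j"
        using q(2)[OF j] by (simp add: field_simps)
      then have "(bary n q j - bary n x j) / m x \<le> bary n q j" using m_pos[of x] by (simp add: field_simps)
      then show ?thesis unfolding bary_r by (simp add: diff_divide_distrib)
    qed
    moreover have "\<forall>i\<ge>n. r x i = 0" using DeltaD(1)[OF n x] q(1) by (simp add: r_def mix_def)
    ultimately show ?thesis by (simp add: Delta_eq[OF n])
  qed
  have r_boundary: "r x \<in> boundary n" if x: "x \<in> Delta n - B" for x
  proof -
    obtain j where j: "j \<le> n" "g x = 1 - bary n x j / bary n q j" using g_eq by blast
    have "m x = g x" using eB[OF x] by (simp add: m_def)
    then have "bary n q j - bary n x j = m x * bary n q j" using j q(2)[OF j(1)] by (simp add: field_simps)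
    then have "bary n (r x) j = 0" using m_pos[of x] unfolding bary_r by (simp add: field_simps)
    then show ?thesis using r_Delta x j(1) by (auto simp: boundary_def)
  qed
  \<comment> \<open>The segment from \<open>x\<close> to \<open>r x\<close> continues the ray from
    \<open>q\<close> through \<open>x\<close>; if it met \<open>B\<close>, convexity would put
    \<open>x\<close> into \<open>B\<close>.\<close>
  have line: "mix s x (r x) \<in> Delta n - B" if s: "s \<in> {0..1}" and x: "x \<in> Delta n - B" for s x
  proof
    show "mix s x (r x) \<in> Delta n" using x s r_Delta by (intro mix_Delta[OF n]) auto
    show "mix s x (r x) \<notin> B"
    proof
      assume in_B: "mix s x (r x) \<in> B"
      define u where "u = (1 - s) + s * (1 / m x)"
      have "m x \<le> 1" using eB[OF x] g_le x by (simp add: m_def)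
      then have "1 \<le> 1 / m x" using m_pos[of x] by simp
      then have "s * 1 \<le> s * (1 / m x)" using s by (intro mult_left_mono) auto
      then have u: "1 \<le> u" by (simp add: u_def)
      have "mix s x (r x) = mix u q x"
        by (simp add: mix_def r_def u_def fun_eq_iff algebra_simps)
      then have "mix u q x \<in> B" using in_B by simp
      moreover have "1 / u \<in> {0..1}" using u by simp
      ultimately have "mix (1 / u) q (mix u q x) \<in> B" by (rule conv[OF qB])
      moreover have "mix (1 / u) q (mix u q x) = x"
        using u by (simp add: mix_def fun_eq_iff field_simps)
      ultimately show False using x by simp
    qed
  qed
  show ?thesis using r_cont r_Delta r_boundary line by (intro exI[of _ r]) blast
qed

text \<open>Radial projection turns a class relative to the complement of \<open>B\<close> into one
  relative to the boundary. For a boundary point \<open>x\<close> the segment from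
  \<open>f x\<close> to \<open>x\<close> stays in a common face and avoids the interior point
  \<open>f p\<close>, so \<open>f\<close> and the identity induce the same map.\<close>

theorem orientation_preserving_if_faces_preserved:
  assumes n: "1 \<le> n"
    and f: "continuous_on (Delta n) f" "f \<in> Delta n \<rightarrow> Delta n" "inj_on f (Delta n)"
    and faces: "\<And>x j. x \<in> Delta n \<Longrightarrow> j \<le> n \<Longrightarrow> bary n (f x) j = 0 \<longleftrightarrow> bary n x j = 0"
  shows "orientation_preserving n (Delta n) f"
  unfolding orientation_preserving_def Euclidean_sub_Delta[OF n]
proof (intro ballI conjI allI impI)
  fix p assume pI: "p \<in> Euclidean_space n interior_of Delta n"
  then have p: "\<forall>i\<ge>n. p i = 0" "\<And>j. j \<le> n \<Longrightarrow> 0 < bary n p j" by (auto simp: interior_Delta[OF n])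
  have pD: "p \<in> Delta n" using pI interior_of_subset by fastforce
  have fpD: "f p \<in> Delta n" using f(2) pD by blast
  have fp: "0 < bary n (f p) j" if "j \<le> n" for j
    using DeltaD(2)[OF n fpD that] faces[OF pD that] p(2)[OF that] by (simp add: less_le)
  then show "f p \<in> Euclidean_space n interior_of Delta n"
    using DeltaD(1)[OF n fpD] by (simp add: interior_Delta[OF n])
  fix B c
  assume B: "convex_ball n B \<and> B \<subseteq> Euclidean_space n interior_of Delta n \<and> p \<in> B \<and> f p \<in> B"
    and c: "c \<in> carrier (relative_homology_group (int n) (top_of_set (Delta n)) (Delta n - B))"
  obtain r where r: "continuous_on (Delta n) r" "r \<in> Delta n \<rightarrow> Delta n" "r \<in> (Delta n - B) \<rightarrow> boundary n"
    and line: "\<And>s x. s \<in> {0..1} \<Longrightarrow> x \<in> Delta n - B \<Longrightarrow> mix s x (r x) \<in> Delta n - B"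
    using radial_projection[OF n, of B] B by blast
  let ?X = "top_of_set (Delta n)" and ?D = "Delta n"
  \<comment> \<open>This one class relative to the boundary yields the localizations of
    \<open>c\<close> at both \<open>p\<close> and \<open>f p\<close>.\<close>
  define c' where "c' = hom_induced (int n) ?X (?D - B) ?X (boundary n) r c"
  have boundary: "x \<in> ?D - {q}" if "x \<in> boundary n" "\<And>j. j \<le> n \<Longrightarrow> 0 < bary n q j" for x q
    using that by (force simp: boundary_def)
  have loc: "localize n ?D B q c = hom_induced (int n) ?X (boundary n) ?X (?D - {q}) id c'"
    if q: "q \<in> B" "\<And>j. j \<le> n \<Longrightarrow> 0 < bary n q j" for q
  proof -
    have "homotopic_with (\<lambda>h. h \<in> (?D - B) \<rightarrow> ?D - {q}) ?X ?X id r"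
      using line q(1) by (intro homotopic_linear[OF n _ _ r(1,2)]) (auto simp: id_def)
    then have "localize n ?D B q c = hom_induced (int n) ?X (?D - B) ?X (?D - {q}) r c"
      unfolding localize_def Euclidean_sub_Delta[OF n] by (simp add: homology_homotopy_axiom)
    also have "\<dots> = hom_induced (int n) ?X (boundary n) ?X (?D - {q}) id c'"
      unfolding c'_def using r boundary[OF _ q(2)] by (subst hom_induced_compose') auto
    finally show ?thesis .
  qed
  have "hom_induced (int n) ?X (?D - {p}) ?X (?D - {f p}) f (localize n ?D B p c)
    = hom_induced (int n) ?X (boundary n) ?X (?D - {f p}) (f \<circ> id) c'"
  proof -
    have "localize n ?D B p c = hom_induced (int n) ?X (boundary n) ?X (?D - {p}) id c'"
      using B p(2) by (intro loc) auto
    moreover have "f \<in> ?D - {p} \<rightarrow> ?D - {f p}" using f(2,3) pD by (auto simp: inj_on_def)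
    moreover have "id \<in> boundary n \<rightarrow> ?D - {p}" using boundary[OF _ p(2)] by simp
    ultimately show ?thesis using f(1,2) by (simp add: hom_induced_compose')
  qed
  also have "\<dots> = hom_induced (int n) ?X (boundary n) ?X (?D - {f p}) id c'"
  proof -
    have "homotopic_with (\<lambda>h. h \<in> boundary n \<rightarrow> ?D - {f p}) ?X ?X f id"
    proof (rule homotopic_linear[OF n f(1,2)])
      fix s x assume s: "s \<in> {0..1::real}" and "x \<in> boundary n"
      then obtain j where j: "x \<in> ?D" "j \<le> n" "bary n x j = 0" by (auto simp: boundary_def)
      then have "bary n (mix s (f x) (id x)) j = 0" using faces by (simp add: bary_mix)
      moreover have "mix s (f x) (id x) \<in> ?D" using j f(2) s by (intro mix_Delta[OF n]) auto
      ultimately show "mix s (f x) (id x) \<in> ?D - {f p}" using fp[OF j(2)] by auto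
    qed auto
    then show ?thesis by (simp add: homology_homotopy_axiom)
  qed
  also have "\<dots> = localize n ?D B (f p) c" using loc[of "f p"] B fp by simp
  finally show "hom_induced (int n) ?X (?D - {p}) ?X (?D - {f p}) f (localize n ?D B p c)
    = localize n ?D B (f p) c" .
qed

subsection \<open>The Minkowski function\<close>

text \<open>Iterates of points of \<open>Delta n\<close> stay there, so agreement on
  \<open>Delta n\<close> suffices to replace the matrix maps by \<open>step\<close>.\<close>

lemma cylinder_cong:
  assumes "\<And>x. x \<in> Delta n \<Longrightarrow> F x = G x" "\<And>x. x \<in> Delta n \<Longrightarrow> G x \<in> Delta n"
  shows "cylinder n F = cylinder n G"
proof -
  have *: "(F ^^ i) x = (G ^^ i) x \<and> (G ^^ i) x \<in> Delta n" if "x \<in> Delta n" for i x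
    using that by (induction i) (auto simp: assms)
  show ?thesis
    unfolding cylinder_def by (intro ext Collect_cong) (metis *)
qed

theorem proposition3p2:
  fixes n :: nat
  assumes "n \<ge> 1"
  shows "homeomorphic_map (Euclidean_sub n (Delta n)) (Euclidean_sub n (Delta n)) (Minkowski n)
    \<and> orientation_preserving n (Delta n) (Minkowski n)"
proof -
  note n = \<open>n \<ge> 1\<close>
  interpret AB: fold_map_pair n 1 "1 / 2" by unfold_locales (use n in auto)
  \<comment> \<open>The swapped pair supplies the transfer in the opposite direction, for
    injectivity and for the converse on faces.\<close>
  interpret BA: fold_map_pair n "1 / 2" 1 by unfold_locales
  have phi: "phi n = AB.A.coded"
    unfolding phi_def coded_point_def fun_eq_iff
    by (subst cylinder_cong[of n "moenkemeyer n" "step n 1"]) (auto simp: moenkemeyer_eq_step[OF n] AB.A.F_Delta)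
  have upsilon: "upsilon n = AB.B.coded"
    unfolding upsilon_def coded_point_def fun_eq_iff
    by (subst cylinder_cong[of n "tent n" "step n (1 / 2)"]) (auto simp: tent_eq_step[OF n] AB.B.F_Delta)
  let ?f = "Minkowski n" and ?D = "Delta n"
  \<comment> \<open>The transfer of equality makes the value independent of the chosen code.\<close>
  have f: "?f (AB.A.coded a) = AB.B.coded a" for a
    unfolding Minkowski_def phi upsilon using AB.coded_eq_transfer by (intro the_equality) blast+
  have f_Delta: "?f ` ?D = ?D"
    using f AB.A.coded_surj AB.A.coded_Delta AB.B.coded_surj AB.B.coded_Delta by (metis (no_types, opaque_lifting) image_eqI image_subsetI subsetI subset_antisym)
  have inj: "inj_on ?f ?D"
  proof (rule inj_onI)
    fix x y assume "x \<in> ?D" "y \<in> ?D" and eq: "?f x = ?f y"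
    then obtain a b where ab: "x = AB.A.coded a" "y = AB.A.coded b" using AB.A.coded_surj by metis
    then have "AB.B.coded a = AB.B.coded b" using eq f by simp
    then show "x = y" unfolding ab by (rule BA.coded_eq_transfer)
  qed
  \<comment> \<open>The code space is compact and \<open>AB.A.coded\<close> maps it continuously
    onto the simplex, so this map is closed and the continuity of \<open>AB.B.coded\<close> descends
    to its factor.\<close>
  have cont: "continuous_on ?D ?f"
    unfolding continuous_on_closed_vimage[OF closed_Delta[OF n]]
  proof (intro allI impI)
    fix S :: "(nat \<Rightarrow> real) set" assume "closed S"
    have "compact (AB.B.coded -` S)"
      using closed_vimage[OF \<open>closed S\<close> AB.B.continuous_on_coded] compact_bool_sequences
      by (metis Int_UNIV_left compact_Int_closed)
    then have "compact (AB.A.coded ` (AB.B.coded -` S))"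
      using AB.A.continuous_on_coded by (meson compact_continuous_image continuous_on_subset subset_UNIV)
    moreover have "?f -` S \<inter> ?D = AB.A.coded ` (AB.B.coded -` S)"
    proof (intro subset_antisym subsetI)
      fix x assume x: "x \<in> ?f -` S \<inter> ?D"
      then obtain a where "x = AB.A.coded a" using AB.A.coded_surj by blast
      then show "x \<in> AB.A.coded ` (AB.B.coded -` S)" using x f by simp
    next
      fix x assume "x \<in> AB.A.coded ` (AB.B.coded -` S)"
      then show "x \<in> ?f -` S \<inter> ?D" using f AB.A.coded_Delta by auto
    qed
    ultimately show "closed (?f -` S \<inter> ?D)" by (simp add: compact_imp_closed)
  qed
  obtain g where "homeomorphism ?D ?D ?f g"
    using homeomorphism_compact[OF compact_Delta[OF n] cont f_Delta inj] by blast
  then have "homeomorphic_maps (top_of_set ?D) (top_of_set ?D) ?f g"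
    by (auto simp: homeomorphism_def homeomorphic_maps_def)
  then have 1: "homeomorphic_map (Euclidean_sub n ?D) (Euclidean_sub n ?D) ?f"
    unfolding Euclidean_sub_Delta[OF n] homeomorphic_map_maps by blast
  have faces: "bary n (?f x) j = 0 \<longleftrightarrow> bary n x j = 0" if "x \<in> ?D" "j \<le> n" for x j
    using AB.A.coded_surj[OF that(1)] AB.coded_zero_transfer BA.coded_zero_transfer f that(2) by metis
  have 2: "orientation_preserving n ?D ?f"
    using f_Delta by (intro orientation_preserving_if_faces_preserved n cont inj faces) auto
  show ?thesis using 1 2 by blast
qed

end
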